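(* Suppose the data are generated from an instrumental variable model in the sense of any of $\mathcal{M}_1,\dots,\mathcal{M}_5$, and let $P_0$ be the underlying joint distribution of $(Y(x_1),\dots,Y(x_K))$. For each $z\in[Q]$, $n_z$ independent observations of $(X,Y)$ are drawn from $P(X,Y\mid Z=z)$, independently across arms, and $\hat p_z$ is the empirical distribution. Let $t_\alpha$ satisfy $\min_{\lambda\in[0,1]}e^{-\lambda t_\alpha}\prod_{z=1}^QG_{KM,n_z}(\lambda)\le\alpha$. For linear functionals $f_1,\dots,f_J$ on $\mathbb{R}^{M^K}$, let $$l_j=\min f_j(p'),\quad u_j=\max f_j(p')$$ over variables $p'\in\Delta^{M^K-1}$, $p_z\in\Delta^{KM-1}$ ($z\in[Q]$) subject to $H'p'\le Hp_z$ for all $z\in[Q]$ and $\sum_{z=1}^Qn_z\,\mathcal{D}_{\mathrm{KL}}(\hat p_z\,\|\,p_z)\le t_\alpha$ (with $l_j=+\infty$, $u_j=-\infty$ if infeasible). Then with probability at least $1-\alpha$, simultaneously for all $j\in[J]$, $l_j\le u_j$ and $f_j(P_0)\in[l_j,u_j]$.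
   Context: Notation: $[n]=\{1,\dots,n\}$; $\Delta^{d-1}$ probability simplex in $\mathbb{R}^d$; $\mathcal{D}_{\mathrm{KL}}$ Kullback–Leibler divergence. Setting: $Y\in[M]$, $X\in[K]$, $Z\in[Q]$, potential outcomes $Y(x_i,z_q)$ and (where used) $X(z_q)$, consistency $Y=Y(X,Z)$, $X=X(Z)$, $Y(x_i):=Y(x_i,Z)$, latent $U$. Exclusion: (E1) $Y(x_i,z)=Y(x_i,\tilde z)$ a.s.; (E2) $(Y(x_k,z))_{k}$ equal in distribution to $(Y(x_k,\tilde z))_k$; (E3) $Y(x,z)\mid U$ equal in distribution to $Y(x,\tilde z)\mid U$. Independence: (I1) $Z\perp\!\!\!\perp\{Y(x,z),X(z)\}$; (I2) $Z\perp\!\!\!\perp\{Y(x,z)\}$; (I3) $Z\perp\!\!\!\perp(X(z),Y(x,z))$ for all $z,x$; (I4) exists $U$ with $U\perp\!\!\!\perp Z$ and $Y(x,z)\perp\!\!\!\perp(X,Z)\mid U$. Models: $\mathcal{M}_1$=(E1)+(I1), $\mathcal{M}_2$=(E1)+(I2), $\mathcal{M}_3$=(E2)+(I2), $\mathcal{M}_4$=(E1)+(I3), $\mathcal{M}_5$=(E3)+(I4). The matrices $H'\in\{0,1\}^{r\times M^K}$, $H\in\{0,1\}^{r\times KM}$ encode, one per row, the inequalities $P'(Y(x_1)\in\mathcal{V}^{(1)},\dots,Y(x_K)\in\mathcal{V}^{(K)})\le\sum_{k}P(X=k,Y\in\mathcal{V}^{(k)}\mid Z=z)$ for tuples of non-empty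 $\mathcal{V}^{(k)}\subseteq[M]$ satisfying either (1) $\mathcal{V}^{(k)},\mathcal{V}^{(k^* )}\ne[M]$ for some $k\ne k^*$ or (2) $\mathcal{V}^{(k^* )}=[M]\setminus\{m\}$ and $\mathcal{V}^{(k)}=[M]$ for $k\ne k^*$ (row of $H'$ = indicator of $\mathcal{V}^{(1)}\times\dots\times\mathcal{V}^{(K)}$ in $[M]^K$; row of $H$ = indicator of $\bigcup_k\{k\}\times\mathcal{V}^{(k)}$ in $[K]\times[M]$). The polynomial $G_{d,n}(\lambda):=\sum_{m=0}^{n}\frac{n!}{n^m(n-m)!}\binom{m+d-2}{d-2}\lambda^m$. *)

theory Defs
  imports "HOL-Probability.Probability"
begin

(* Conventions: [n] is rendered 0-based as {..<n}.  x_k, k < K; z_q, q < Q; m < M.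
   A point of [M]^K is an extensional function v \<in> PiE {..<K} (\<lambda>_. {..<M}). *)

abbreviation cnt :: "'a measure" where "cnt \<equiv> count_space UNIV"

definition tuples :: "nat \<Rightarrow> nat \<Rightarrow> (nat \<Rightarrow> nat) set" where
  "tuples K M = PiE {..<K} (\<lambda>_. {..<M})"

definition cells :: "nat \<Rightarrow> nat \<Rightarrow> (nat \<times> nat) set" where
  "cells K M = {..<K} \<times> {..<M}"

definition simplex_on :: "'a set \<Rightarrow> ('a \<Rightarrow> real) \<Rightarrow> bool" where
  "simplex_on A p \<longleftrightarrow> (\<forall>a\<in>A. 0 \<le> p a) \<and> (\<Sum>a\<in>A. p a) = 1"

definition IV_rows :: "nat \<Rightarrow> nat \<Rightarrow> (nat \<Rightarrow> nat set) set" where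
  "IV_rows K M = {V \<in> PiE {..<K} (\<lambda>_. Pow {..<M} - {{}}).
      (\<exists>k<K. \<exists>k'<K. k \<noteq> k' \<and> V k \<noteq> {..<M} \<and> V k' \<noteq> {..<M})
    \<or> (\<exists>k'<K. \<exists>m<M. V k' = {..<M} - {m} \<and> (\<forall>k<K. k \<noteq> k' \<longrightarrow> V k = {..<M}))}"

definition H'_entry :: "nat \<Rightarrow> (nat \<Rightarrow> nat set) \<Rightarrow> (nat \<Rightarrow> nat) \<Rightarrow> real" where
  "H'_entry K V v = indicator (PiE {..<K} V) v"

definition H_entry :: "nat \<Rightarrow> (nat \<Rightarrow> nat set) \<Rightarrow> nat \<times> nat \<Rightarrow> real" where
  "H_entry K V a = indicator (SIGMA k:{..<K}. V k) a"

definition KL_div :: "'a set \<Rightarrow> ('a \<Rightarrow> real) \<Rightarrow> ('a \<Rightarrow> real) \<Rightarrow> ereal" where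
  "KL_div A ph p = (\<Sum>a\<in>A. if ph a = 0 then 0 else if p a = 0 then \<infinity>
                              else ereal (ph a * ln (ph a / p a)))"

definition G_poly :: "nat \<Rightarrow> nat \<Rightarrow> real \<Rightarrow> real" where
  "G_poly d n l = (\<Sum>m=0..n. fact n / (real n ^ m * fact (n - m))
                         * real ((m + d - 2) choose (d - 2)) * l ^ m)"

definition feasible ::
  "nat \<Rightarrow> nat \<Rightarrow> nat \<Rightarrow> (nat \<Rightarrow> nat) \<Rightarrow> real \<Rightarrow> (nat \<Rightarrow> nat \<times> nat \<Rightarrow> real)
   \<Rightarrow> ((nat \<Rightarrow> nat) \<Rightarrow> real) \<Rightarrow> (nat \<Rightarrow> nat \<times> nat \<Rightarrow> real) \<Rightarrow> bool" where
  "feasible K M Q n t ph p' p \<longleftrightarrow>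
     simplex_on (tuples K M) p'
   \<and> (\<forall>q<Q. simplex_on (cells K M) (p q))
   \<and> (\<forall>q<Q. \<forall>V\<in>IV_rows K M.
        (\<Sum>v\<in>tuples K M. H'_entry K V v * p' v) \<le> (\<Sum>a\<in>cells K M. H_entry K V a * p q a))
   \<and> (\<Sum>q<Q. ereal (real (n q)) * KL_div (cells K M) (ph q) (p q)) \<le> ereal t"

definition lin_fun :: "nat \<Rightarrow> nat \<Rightarrow> ((nat \<Rightarrow> nat) \<Rightarrow> real) \<Rightarrow> ((nat \<Rightarrow> nat) \<Rightarrow> real) \<Rightarrow> real" where
  "lin_fun K M c p' = (\<Sum>v\<in>tuples K M. c v * p' v)"

(* l_j and u_j (min resp. max; +\<infinity> resp. -\<infinity> if infeasible) *)
definition lower_bd where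
  "lower_bd K M Q n t ph c = Inf {ereal (lin_fun K M c p') | p' p. feasible K M Q n t ph p' p}"
definition upper_bd where
  "upper_bd K M Q n t ph c = Sup {ereal (lin_fun K M c p') | p' p. feasible K M Q n t ph p' p}"

definition emp_dist :: "(nat \<Rightarrow> nat) \<Rightarrow> (nat \<times> nat \<Rightarrow> nat \<times> nat) \<Rightarrow> nat \<Rightarrow> nat \<times> nat \<Rightarrow> real" where
  "emp_dist n s q a = real (card {i. i < n q \<and> s (q, i) = a}) / real (n q)"

definition sample_index :: "nat \<Rightarrow> (nat \<Rightarrow> nat) \<Rightarrow> (nat \<times> nat) set" where
  "sample_index Q n = {(q, i). q < Q \<and> i < n q}"

definition cprob :: "'w measure \<Rightarrow> 'w measure \<Rightarrow> 'w set \<Rightarrow> 'w \<Rightarrow> real" where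
  "cprob Mp F A = real_cond_exp Mp F (indicator A)"

definition sigma_of :: "'w measure \<Rightarrow> ('w \<Rightarrow> 'u) \<Rightarrow> 'u measure \<Rightarrow> 'w measure" where
  "sigma_of Mp U MU = vimage_algebra (space Mp) U MU"

definition cond_indep :: "'w measure \<Rightarrow> 'w measure \<Rightarrow> ('w \<Rightarrow> 'a) \<Rightarrow> ('w \<Rightarrow> 'b) \<Rightarrow> bool" where
  "cond_indep Mp F V W \<longleftrightarrow> (\<forall>A B. AE \<omega> in Mp.
      cprob Mp F ({w\<in>space Mp. V w \<in> A} \<inter> {w\<in>space Mp. W w \<in> B}) \<omega>
      = cprob Mp F {w\<in>space Mp. V w \<in> A} \<omega> * cprob Mp F {w\<in>space Mp. W w \<in> B} \<omega>)"

(* independence of two random variables with possibly different codomain types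
   (the library's indep_var forces equal codomain types; this is indep_var_eq
   with the generating sets, generalised to heterogeneous types) *)
definition indep_rv :: "'w measure \<Rightarrow> 'a measure \<Rightarrow> ('w \<Rightarrow> 'a) \<Rightarrow> 'b measure \<Rightarrow> ('w \<Rightarrow> 'b) \<Rightarrow> bool" where
  "indep_rv Mp Ma A Mb B \<longleftrightarrow> A \<in> measurable Mp Ma \<and> B \<in> measurable Mp Mb \<and>
     prob_space.indep_set Mp {A -` S \<inter> space Mp | S. S \<in> sets Ma} {B -` S \<inter> space Mp | S. S \<in> sets Mb}"

definition Yfam :: "nat \<Rightarrow> nat \<Rightarrow> (nat \<Rightarrow> nat \<Rightarrow> 'w \<Rightarrow> nat) \<Rightarrow> 'w \<Rightarrow> (nat \<times> nat \<Rightarrow> nat)" where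
  "Yfam K Q Yp w = restrict (\<lambda>(k, q). Yp k q w) ({..<K} \<times> {..<Q})"

definition Yfam_space :: "nat \<Rightarrow> nat \<Rightarrow> (nat \<times> nat \<Rightarrow> nat) measure" where
  "Yfam_space K Q = PiM ({..<K} \<times> {..<Q}) (\<lambda>_. cnt)"

definition E1 where
  "E1 Mp K Q Yp \<longleftrightarrow> (\<forall>k<K. \<forall>q<Q. \<forall>q'<Q. AE w in Mp. Yp k q w = Yp k q' w)"

definition E2 where
  "E2 Mp K Q Yp \<longleftrightarrow> (\<forall>q<Q. \<forall>q'<Q.
     distr Mp (PiM {..<K} (\<lambda>_. cnt)) (\<lambda>w. restrict (\<lambda>k. Yp k q w) {..<K})
   = distr Mp (PiM {..<K} (\<lambda>_. cnt)) (\<lambda>w. restrict (\<lambda>k. Yp k q' w) {..<K}))"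

definition E3 where
  "E3 Mp K Q Yp U MU \<longleftrightarrow> (\<forall>k<K. \<forall>q<Q. \<forall>q'<Q. \<forall>A::nat set. AE w in Mp.
     cprob Mp (sigma_of Mp U MU) {w'\<in>space Mp. Yp k q w' \<in> A} w
   = cprob Mp (sigma_of Mp U MU) {w'\<in>space Mp. Yp k q' w' \<in> A} w)"

definition I1 where
  "I1 Mp K Q Z Yp Xp \<longleftrightarrow> indep_rv Mp cnt Z
     (Yfam_space K Q \<Otimes>\<^sub>M PiM {..<Q} (\<lambda>_. cnt))
     (\<lambda>w. (Yfam K Q Yp w, restrict (\<lambda>q. Xp q w) {..<Q}))"

definition I2 where
  "I2 Mp K Q Z Yp \<longleftrightarrow> indep_rv Mp cnt Z (Yfam_space K Q) (Yfam K Q Yp)"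

definition I3 where
  "I3 Mp K Q Z Yp Xp \<longleftrightarrow> (\<forall>q<Q. \<forall>k<K.
     indep_rv Mp cnt Z (cnt \<Otimes>\<^sub>M cnt) (\<lambda>w. (Xp q w, Yp k q w)))"

definition I4 where
  "I4 Mp K Q X Z Yp U MU \<longleftrightarrow> indep_rv Mp MU U cnt Z
     \<and> (\<forall>k<K. \<forall>q<Q. cond_indep Mp (sigma_of Mp U MU) (Yp k q) (\<lambda>w. (X w, Z w)))"

definition consX where
  "consX Mp X Z Xp \<longleftrightarrow> (AE w in Mp. X w = Xp (Z w) w)"

definition IV_model ::
  "'w measure \<Rightarrow> nat \<Rightarrow> nat \<Rightarrow> ('w \<Rightarrow> nat) \<Rightarrow> ('w \<Rightarrow> nat) \<Rightarrow> (nat \<Rightarrow> nat \<Rightarrow> 'w \<Rightarrow> nat)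
   \<Rightarrow> (nat \<Rightarrow> 'w \<Rightarrow> nat) \<Rightarrow> ('w \<Rightarrow> 'u) \<Rightarrow> 'u measure \<Rightarrow> bool" where
  "IV_model Mp K Q X Z Yp Xp U MU \<longleftrightarrow>
       (E1 Mp K Q Yp \<and> I1 Mp K Q Z Yp Xp \<and> consX Mp X Z Xp)
     \<or> (E1 Mp K Q Yp \<and> I2 Mp K Q Z Yp)
     \<or> (E2 Mp K Q Yp \<and> I2 Mp K Q Z Yp)
     \<or> (E1 Mp K Q Yp \<and> I3 Mp K Q Z Yp Xp \<and> consX Mp X Z Xp)
     \<or> (E3 Mp K Q Yp U MU \<and> I4 Mp K Q X Z Yp U MU)"

(* joint distribution P_0 of (Y(x_1),...,Y(x_K)), with Y(x_k) = Y(x_k, Z) *)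
definition P0 :: "'w measure \<Rightarrow> nat \<Rightarrow> ('w \<Rightarrow> nat) \<Rightarrow> (nat \<Rightarrow> nat \<Rightarrow> 'w \<Rightarrow> nat) \<Rightarrow> (nat \<Rightarrow> nat) \<Rightarrow> real" where
  "P0 Mp K Z Yp v = measure Mp {w\<in>space Mp. \<forall>k<K. Yp k (Z w) w = v k}"

definition cond_XY :: "'w measure \<Rightarrow> ('w \<Rightarrow> nat) \<Rightarrow> ('w \<Rightarrow> nat) \<Rightarrow> ('w \<Rightarrow> nat) \<Rightarrow> nat \<Rightarrow> nat \<times> nat \<Rightarrow> real" where
  "cond_XY Mp X Y Z q a = measure Mp {w\<in>space Mp. X w = fst a \<and> Y w = snd a \<and> Z w = q}
                         / measure Mp {w\<in>space Mp. Z w = q}"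

end

theory Submission
  imports Defs
begin

text \<open>
  The true pair (\<open>P0\<close>, conditional laws of \<open>(X, Y)\<close> given \<open>Z\<close>) satisfies all linear constraints of the
  program, so the intervals can only fail to cover when the Kullback--Leibler constraint fails at
  the true conditional laws.

  For the linear constraints, the latent-variable model only controls the marginals of the
  \<open>Y(x, z)\<close> given \<open>U\<close>. This suffices: given \<open>U\<close>, the joint event has probability at most
  \<open>min\<^sub>k P(Y(x\<^sub>k) \<in> V\<^sub>k | U)\<close>, while the right-hand side averages these numbers over \<open>k\<close>.

  For the Kullback--Leibler constraint, Markov's inequality reduces the claim to
  \<open>E exp(l n KL(ph, p)) \<le> G(l)\<close>. The expectation is a sum over samples of products of
  \<open>p\<^bsup>1-l\<^esup> ph\<^bsup>l\<^esup>\<close>. Replacing each factor by the larger \<open>(1 - l) p + l ph\<close> makes the sum computable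
  by a multinomial identity of Abel type, and its value does not depend on \<open>p\<close>: it is exactly \<open>G(l)\<close>.
\<close>

section \<open>An Abel-type multinomial identity\<close>

text \<open>\<open>abel d C n\<close> is the coefficient of \<open>u\<^sup>n\<close> in \<open>exp ((C + n) u) / (1 - u)\<^sup>d\<close>.\<close>

fun abel :: "nat \<Rightarrow> real \<Rightarrow> nat \<Rightarrow> real" where
  "abel 0 C n = (C + real n) ^ n / fact n"
| "abel (Suc d) C n = (\<Sum>j\<le>n. abel d (C + real j) (n - j))"

lemma abel_0_0: "abel 0 C 0 = 1"
  by simp

text \<open>The summand \<open>j = 0\<close> is split off; in the others the shift by one moves into
  the parameter \<open>C\<close>.\<close>

lemma abel_Suc_Suc: "abel (Suc d) C (Suc n) = abel d C (Suc n) + abel (Suc d) (C + 1) n"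
  by (simp add: sum.atMost_Suc_shift algebra_simps del: sum.atMost_Suc)

text \<open>Multiply the binomial series of \<open>1 / (1 - u)^(d + 1)\<close> by the exponential
  series of \<open>exp ((C + n) u)\<close> and read off the coefficient of
  \<open>u^n\<close>.\<close>

lemma abel_closed_form:
  "abel (Suc d) C n = (\<Sum>m\<le>n. real ((m + d) choose d) * ((C + real n) ^ (n - m) / fact (n - m)))"
proof (induction d arbitrary: C n)
  case 0
  then show ?case by (auto simp: of_nat_diff intro!: sum.cong)
next
  case (Suc d)
  define w where "w l = (C + real n) ^ (n - l) / fact (n - l)" for l
  \<comment> \<open>Because \<open>(C + j) + (n - j) = C + n\<close>, all inner sums share one base,
    so the weight depends on \<open>j + m\<close> alone.\<close>
  have "abel (Suc (Suc d)) C n = (\<Sum>j\<le>n. \<Sum>m\<le>n - j. real ((m + d) choose d) * w (j + m))"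
    by (subst abel.simps(2), subst Suc) (auto simp: w_def of_nat_diff intro!: sum.cong)
  also have "\<dots> = (\<Sum>(j, m)\<in>{(j, m). j + m \<le> n}. real ((m + d) choose d) * w (j + m))"
    by (subst sum.Sigma) (auto intro!: sum.cong)
  also have "\<dots> = (\<Sum>l\<le>n. \<Sum>j\<le>l. real ((l - j + d) choose d) * w l)"
    by (subst sum.triangle_reindex_eq) (auto intro!: sum.cong)
  also have "\<dots> = (\<Sum>l\<le>n. (\<Sum>j\<le>l. real ((d + j) choose d)) * w l)"
    by (intro sum.cong refl, subst sum.nat_diff_reindex[symmetric, of _ "Suc _", unfolded lessThan_Suc_atMost])
       (auto simp: sum_distrib_right add.commute intro!: sum.cong)
  \<comment> \<open>Hockey-stick identity for the column \<open>d\<close> of Pascal's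
    triangle.\<close>
  also have "\<dots> = (\<Sum>l\<le>n. real ((l + Suc d) choose Suc d) * w l)"
    using choose_rising_sum(1)[of d] by (simp flip: of_nat_sum add: algebra_simps)
  finally show ?case by (simp add: w_def)
qed

text \<open>Lowering the index and raising the parameter by one keeps the base of the power, so
  differentiation sends one Abel polynomial to another.\<close>

lemma abel_0_deriv_Suc:
  "((\<lambda>x. abel 0 (c + m * x) (Suc k)) has_real_derivative m * abel 0 (c + m * x + 1) k) (at x)"
  by (auto intro!: derivative_eq_intros simp: field_simps simp del: power_Suc of_nat_Suc) (simp add: algebra_simps)

text \<open>By induction, the derivative along \<open>a + b = s\<close> vanishes, so the left-hand side may be evaluated
  at \<open>b = 0\<close>, where it telescopes into the case \<open>b = 1\<close> of the induction hypothesis.\<close>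

lemma abel_convolution_0: "(\<Sum>k\<le>n. abel 0 a k * abel 0 b (n - k)) = abel 1 (a + b) n"
proof (induction n arbitrary: a b)
  case 0
  then show ?case by simp
next
  case (Suc n)
  define s where "s = a + b"
  define g where "g x = (\<Sum>k\<le>Suc n. abel 0 (s - x) k * abel 0 x (Suc n - k))" for x
  have D1: "((\<lambda>x. abel 0 (s - x) k) has_real_derivative (if k = 0 then 0 else - abel 0 (s - x + 1) (k - 1))) (at x)" for x k
    using abel_0_deriv_Suc[of s "-1" "k - 1" x] by (cases k) auto
  have D2: "((\<lambda>x. abel 0 x k) has_real_derivative (if k = 0 then 0 else abel 0 (x + 1) (k - 1))) (at x)" for x k
    using abel_0_deriv_Suc[of 0 1 "k - 1" x] by (cases k) auto
  have "(g has_real_derivative 0) (at x)" for x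
  proof -
    have "(g has_real_derivative (\<Sum>k\<le>Suc n.
        (if k = 0 then 0 else - abel 0 (s - x + 1) (k - 1)) * abel 0 x (Suc n - k)
      + (if Suc n - k = 0 then 0 else abel 0 (x + 1) (Suc n - k - 1)) * abel 0 (s - x) k)) (at x)"
      unfolding g_def by (intro DERIV_sum DERIV_mult D1 D2)
    also have "(\<Sum>k\<le>Suc n.
        (if k = 0 then 0 else - abel 0 (s - x + 1) (k - 1)) * abel 0 x (Suc n - k)
      + (if Suc n - k = 0 then 0 else abel 0 (x + 1) (Suc n - k - 1)) * abel 0 (s - x) k)
      = - (\<Sum>k\<le>n. abel 0 (s - x + 1) k * abel 0 x (n - k)) + (\<Sum>k\<le>n. abel 0 (s - x) k * abel 0 (x + 1) (n - k))"
      unfolding sum.distrib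
      by (subst sum.atMost_Suc_shift)
         (auto simp: sum_negf Suc_diff_le mult.commute simp del: abel.simps intro!: sum.cong)
    \<comment> \<open>In both sums the parameters add up to \<open>s + 1\<close>, so the induction
      hypothesis gives both the value \<open>abel 1 (s + 1) n\<close>.\<close>
    also have "\<dots> = 0"
      unfolding Suc by (simp del: abel.simps add: algebra_simps)
    finally show ?thesis .
  qed
  then have "g b = g 0" by (intro DERIV_isconst_all) auto
  also have "\<dots> = (\<Sum>k\<le>n. abel 0 s k * abel 0 0 (Suc (n - k))) + abel 0 s (Suc n)"
    by (auto simp: g_def Suc_diff_le abel_0_0 simp del: abel.simps intro!: sum.cong)
  \<comment> \<open>This rests on \<open>(m + 1)^(m + 1) / (m + 1)! = (m + 1)^m / m!\<close> with
    \<open>m = n - k\<close>.\<close>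
  also have "(\<Sum>k\<le>n. abel 0 s k * abel 0 0 (Suc (n - k))) = (\<Sum>k\<le>n. abel 0 s k * abel 0 1 (n - k))"
    by (intro sum.cong refl arg_cong2[where f = "(*)"]) (simp add: add.commute)
  also have "\<dots> = abel 1 (s + 1) n" by (rule Suc)
  finally show ?case
    using abel_Suc_Suc[of 0 s n] by (simp add: g_def s_def del: abel.simps)
qed

text \<open>Raising \<open>d\<close> adds an inner sum over \<open>j\<close> on both sides.
  Exchanging the two sums over the triangle \<open>j + k \<le> n\<close> leaves the induction
  hypothesis with parameter \<open>b + j\<close>.\<close>

lemma abel_convolution: "(\<Sum>k\<le>n. abel 0 a k * abel d b (n - k)) = abel (Suc d) (a + b) n"
proof (induction d arbitrary: b n)
  case 0
  then show ?case using abel_convolution_0 by simp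
next
  case (Suc d)
  have "(\<Sum>k\<le>n. abel 0 a k * abel (Suc d) b (n - k))
      = (\<Sum>k\<le>n. \<Sum>j\<le>n - k. abel 0 a k * abel d (b + real j) (n - k - j))"
    by (simp add: sum_distrib_left)
  also have "\<dots> = (\<Sum>j\<le>n. \<Sum>k\<le>n - j. abel 0 a k * abel d (b + real j) (n - j - k))"
    unfolding sum.Sigma[OF finite_atMost, OF ballI, OF finite_atMost]
    by (rule sum.reindex_bij_witness[of _ prod.swap prod.swap]) (auto simp: add.commute)
  also have "\<dots> = abel (Suc (Suc d)) (a + b) n"
    unfolding Suc by (simp add: add.assoc)
  finally show ?case .
qed

section \<open>Sums over all functions into a finite set\<close>

lemma sum_Pow_card:
  fixes f :: "nat \<Rightarrow> real"
  assumes "finite I"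
  shows "(\<Sum>S\<in>Pow I. f (card S)) = (\<Sum>k\<le>card I. real (card I choose k) * f k)"
proof -
  have "(\<Sum>S\<in>Pow I. f (card S)) = (\<Sum>k\<le>card I. \<Sum>S\<in>{S \<in> Pow I. card S = k}. f (card S))"
    using assms by (intro sum.group[symmetric]) (auto intro: card_mono)
  also have "\<dots> = (\<Sum>k\<le>card I. real (card I choose k) * f k)"
    using assms by (intro sum.cong refl) (simp add: n_subsets)
  finally show ?thesis .
qed

text \<open>A function into \<open>insert a A\<close> is the same as its fibre \<open>S\<close> over
  \<open>a\<close> together with its restriction to \<open>I - S\<close>, which takes values in
  \<open>A\<close>.\<close>

lemma sum_PiE_insert_range:
  assumes "a \<notin> A" "finite I" "finite A"
  shows "(\<Sum>s\<in>I \<rightarrow>\<^sub>E insert a A. f s)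
       = (\<Sum>S\<in>Pow I. \<Sum>s\<in>(I - S) \<rightarrow>\<^sub>E A. f (\<lambda>i. if i \<in> S then a else s i))"
proof -
  have "(\<Sum>s\<in>I \<rightarrow>\<^sub>E insert a A. f s)
      = (\<Sum>(S, s)\<in>(SIGMA S:Pow I. (I - S) \<rightarrow>\<^sub>E A). f (\<lambda>i. if i \<in> S then a else s i))"
  proof (rule sum.reindex_bij_witness[where j = "\<lambda>s. ({i \<in> I. s i = a}, restrict s (I - {i \<in> I. s i = a}))"
        and i = "\<lambda>(S, s) i. if i \<in> S then a else s i"], goal_cases)
    case (1 s)
    then show ?case by (auto simp: fun_eq_iff PiE_iff extensional_def restrict_def)
  next
    case (2 s)
    then show ?case by (auto simp: PiE_iff)
  next
    case (3 p)
    then show ?case using assms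
      by (cases p) (auto simp: fun_eq_iff PiE_iff extensional_def restrict_def split: if_splits)
  next
    case (4 p)
    then show ?case using assms
      by (cases p) (auto simp: PiE_iff extensional_def split: if_splits)
  next
    case (5 s)
    then show ?case
      by (auto intro!: arg_cong[where f = f] simp: fun_eq_iff PiE_iff extensional_def restrict_def)
  qed
  also have "\<dots> = (\<Sum>S\<in>Pow I. \<Sum>s\<in>(I - S) \<rightarrow>\<^sub>E A. f (\<lambda>i. if i \<in> S then a else s i))"
    using assms by (subst sum.Sigma) (auto intro!: finite_PiE)
  finally show ?thesis .
qed

text \<open>Induction on the alphabet: fixing the fibre of a new letter leaves the same sum on a
  smaller index set, and summing over fibre sizes is an Abel convolution. The result depends on
  \<open>c\<close> only through its total, which later removes the unknown law.\<close>

lemma sum_functions_abel: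
  assumes "finite A" "A \<noteq> {}" "finite I"
  shows "(\<Sum>s\<in>I \<rightarrow>\<^sub>E A. \<Prod>a\<in>A. (c a + real (card {i \<in> I. s i = a})) ^ card {i \<in> I. s i = a})
       = fact (card I) * abel (card A - 1) (sum c A) (card I)"
  using assms
proof (induction A arbitrary: I rule: finite_ne_induct)
  case (singleton a)
  have "I \<rightarrow>\<^sub>E {a} = {restrict (\<lambda>_. a) I}"
    by (auto simp: PiE_iff extensional_def fun_eq_iff)
  then show ?case by simp
next
  case (insert a A)
  \<comment> \<open>The index set is an argument of \<open>w\<close> because the induction
    hypothesis is applied on \<open>I - S\<close>.\<close>
  define w where "w = (\<lambda>(I::'b set) s b. (c b + real (card {i \<in> I. s i = b})) ^ card {i \<in> I. s i = b})"
  have fI: "finite I" by fact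
  have "(\<Sum>s\<in>I \<rightarrow>\<^sub>E insert a A. \<Prod>b\<in>insert a A. w I s b)
      = (\<Sum>S\<in>Pow I. \<Sum>s\<in>(I - S) \<rightarrow>\<^sub>E A. \<Prod>b\<in>insert a A. w I (\<lambda>i. if i \<in> S then a else s i) b)"
    by (intro sum_PiE_insert_range insert fI)
  also have "\<dots> = (\<Sum>S\<in>Pow I. (c a + real (card S)) ^ card S * (\<Sum>s\<in>(I - S) \<rightarrow>\<^sub>E A. \<Prod>b\<in>A. w (I - S) s b))"
  proof (intro sum.cong refl, unfold sum_distrib_left, intro sum.cong refl)
    fix S s assume S: "S \<in> Pow I" and s: "s \<in> (I - S) \<rightarrow>\<^sub>E A"
    have "{i \<in> I. (if i \<in> S then a else s i) = a} = S"
      using S s \<open>a \<notin> A\<close> by (auto simp: PiE_iff)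
    moreover have "{i \<in> I. (if i \<in> S then a else s i) = b} = {i \<in> I - S. s i = b}" if "b \<in> A" for b
      using that \<open>a \<notin> A\<close> by auto
    ultimately show "(\<Prod>b\<in>insert a A. w I (\<lambda>i. if i \<in> S then a else s i) b)
        = (c a + real (card S)) ^ card S * (\<Prod>b\<in>A. w (I - S) s b)"
      using insert by (simp add: w_def)
  qed
  also have "\<dots> = (\<Sum>S\<in>Pow I. (c a + real (card S)) ^ card S
        * (fact (card I - card S) * abel (card A - 1) (sum c A) (card I - card S)))"
  proof (intro sum.cong refl arg_cong2[where f = "(*)"])
    fix S assume "S \<in> Pow I"
    then have card: "card (I - S) = card I - card S"
      using fI by (simp add: card_Diff_subset finite_subset)
    show "(\<Sum>s\<in>(I - S) \<rightarrow>\<^sub>E A. \<Prod>b\<in>A. w (I - S) s b)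
        = fact (card I - card S) * abel (card A - 1) (sum c A) (card I - card S)"
      using insert.IH[OF finite_Diff[OF fI], of S] unfolding w_def card .
  qed
  also have "\<dots> = (\<Sum>k\<le>card I. real (card I choose k) * ((c a + real k) ^ k
        * (fact (card I - k) * abel (card A - 1) (sum c A) (card I - k))))"
    by (rule sum_Pow_card[OF fI])
  \<comment> \<open>The binomial coefficient times \<open>(card I - k)!\<close> is
    \<open>(card I)! / k!\<close>, and the factor \<open>1 / k!\<close> completes
    \<open>abel 0 (c a) k\<close>.\<close>
  also have "\<dots> = fact (card I) * (\<Sum>k\<le>card I. abel 0 (c a) k * abel (card A - 1) (sum c A) (card I - k))"
    unfolding sum_distrib_left by (intro sum.cong refl) (simp add: binomial_fact)
  also have "\<dots> = fact (card I) * abel (card (insert a A) - 1) (sum c (insert a A)) (card I)"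
    using insert by (simp add: abel_convolution card_gt_0_iff del: abel.simps)
  finally show ?case unfolding w_def .
qed

section \<open>Concentration of the empirical distribution in relative entropy\<close>

text \<open>The summand \<open>m = 0\<close> is 1 and the others are nonnegative. This settles the
  degenerate cases \<open>l = 0\<close> and \<open>d = 1\<close> below.\<close>

lemma G_poly_ge_1:
  assumes "0 \<le> l" shows "1 \<le> G_poly d n l"
proof -
  have "(\<Sum>m\<in>{0}. fact n / (real n ^ m * fact (n - m)) * real ((m + d - 2) choose (d - 2)) * l ^ m) \<le> G_poly d n l"
    unfolding G_poly_def using assms by (intro sum_mono2) auto
  then show ?thesis by simp
qed

text \<open>The parameter makes the base \<open>C + n\<close> equal to \<open>n / l\<close>, so the
  prefactor \<open>(l / n)^n\<close> cancels all but \<open>(l / n)^m\<close> in each term of the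
  closed form. For \<open>d \<ge> 2\<close> the proof gives equality.\<close>

lemma abel_le_G_poly:
  assumes "d \<ge> 1" "n \<ge> 1" "0 < l"
  shows "(l / real n) ^ n * (fact n * abel (d - 1) (real n * (1 - l) / l) n) \<le> G_poly d n l"
proof -
  have C: "real n * (1 - l) / l + real n = real n / l"
    using assms by (simp add: field_simps)
  have pow: "(l / real n) ^ n * (real n / l) ^ (n - m) = l ^ m / real n ^ m" if "m \<le> n" for m
  proof -
    have "(l / real n) ^ n = (l / real n) ^ m * (l / real n) ^ (n - m)"
      using that by (simp flip: power_add)
    then show ?thesis using assms by (simp add: power_divide)
  qed
  show ?thesis
  \<comment> \<open>For \<open>d = 1\<close> the left side is 1. Truncated subtraction turns every
    binomial factor of \<open>G_poly\<close> into \<open>_ choose 0 = 1\<close>, so the left side is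
    just its summand \<open>m = 0\<close>.\<close>
  proof (cases "d = 1")
    case True
    then show ?thesis using assms G_poly_ge_1[of l d n] pow[of 0] by (simp add: C)
  next
    case False
    define e where "e = d - 2"
    have d: "d = Suc (Suc e)" using False assms by (simp add: e_def)
    have "(l / real n) ^ n * (fact n * abel (d - 1) (real n * (1 - l) / l) n)
      = (\<Sum>m\<le>n. fact n * real ((m + e) choose e) / fact (n - m) * ((l / real n) ^ n * (real n / l) ^ (n - m)))"
      by (simp add: d abel_closed_form C sum_distrib_left mult_ac del: abel.simps)
    also have "\<dots> = G_poly d n l"
      unfolding G_poly_def atMost_atLeast0
      by (intro sum.cong refl) (subst pow, simp_all add: d)
    finally show ?thesis by simp
  qed
qed

section \<open>Likelihood ratio and exponential moment within one arm\<close>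

lemma prod_comp_card:
  fixes g :: "'a \<Rightarrow> real"
  assumes "finite I" "finite A" "s ` I \<subseteq> A"
  shows "(\<Prod>i\<in>I. g (s i)) = (\<Prod>a\<in>A. g a ^ card {i \<in> I. s i = a})"
proof -
  have "(\<Prod>i\<in>I. g (s i)) = (\<Prod>a\<in>A. \<Prod>i\<in>{i \<in> I. s i = a}. g (s i))"
    by (rule prod.group[symmetric]) (use assms in auto)
  also have "\<dots> = (\<Prod>a\<in>A. g a ^ card {i \<in> I. s i = a})"
    by (intro prod.cong refl) simp
  finally show ?thesis .
qed

lemma sum_comp_card:
  fixes g :: "'a \<Rightarrow> real"
  assumes "finite I" "finite A" "s ` I \<subseteq> A"
  shows "(\<Sum>i\<in>I. g (s i)) = (\<Sum>a\<in>A. real (card {i \<in> I. s i = a}) * g a)"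
proof -
  have "(\<Sum>i\<in>I. g (s i)) = (\<Sum>a\<in>A. \<Sum>i\<in>{i \<in> I. s i = a}. g (s i))"
    by (rule sum.group[symmetric]) (use assms in auto)
  also have "\<dots> = (\<Sum>a\<in>A. real (card {i \<in> I. s i = a}) * g a)"
    by (intro sum.cong refl) simp
  finally show ?thesis .
qed

text \<open>The arithmetic mean, with weights \<open>1 - l\<close> and \<open>l\<close>, of the true
  mass and the empirical frequency. It dominates the geometric mean that occurs in the exponential
  moment.\<close>

definition mixture_weight :: "real \<Rightarrow> ('a \<Rightarrow> real) \<Rightarrow> nat \<Rightarrow> (nat \<Rightarrow> 'a) \<Rightarrow> 'a \<Rightarrow> real" where
  "mixture_weight l p n s a = (1 - l) * p a + l * (real (card {i. i < n \<and> s i = a}) / real n)"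

text \<open>After factoring out \<open>l / n\<close>, the product over the sample groups by letters
  into the form summed by \<open>sum_functions_abel\<close>. The case \<open>l = 0\<close> is
  separate since this divides by \<open>l\<close>.\<close>

lemma sum_mixture_weight_le_G_poly:
  assumes A: "finite A" "A \<noteq> {}" and n: "n \<ge> 1" and l: "0 \<le> l" "l \<le> 1" and p: "simplex_on A p"
  shows "(\<Sum>s\<in>{..<n} \<rightarrow>\<^sub>E A. \<Prod>i<n. mixture_weight l p n s (s i)) \<le> G_poly (card A) n l"
proof (cases "l = 0")
  case True
  have "(\<Sum>s\<in>{..<n} \<rightarrow>\<^sub>E A. \<Prod>i<n. p (s i)) = (\<Prod>i<n. \<Sum>a\<in>A. p a)"
    using A by (intro prod_sum_PiE[symmetric]) auto
  also have "\<dots> = 1" using p by (simp add: simplex_on_def)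
  finally show ?thesis using G_poly_ge_1[of l "card A" n] True by (simp add: mixture_weight_def)
next
  case False
  with l have l0: "0 < l" by simp
  \<comment> \<open>Chosen so that \<open>mixture_weight\<close> equals \<open>l / n\<close> times
    \<open>c a\<close> plus the count of \<open>a\<close>.\<close>
  define c where "c a = real n * (1 - l) / l * p a" for a
  define k where "k s a = card {i \<in> {..<n}. s i = a}" for s :: "nat \<Rightarrow> 'a" and a
  have k_eq: "card {i. i < n \<and> s i = a} = k s a" for s a
    by (simp add: k_def lessThan_def)
  have eq: "(\<Prod>i<n. mixture_weight l p n s (s i)) = (l / real n) ^ n * (\<Prod>a\<in>A. (c a + real (k s a)) ^ k s a)"
    if s: "s \<in> {..<n} \<rightarrow>\<^sub>E A" for s
  proof -
    have im: "s ` {..<n} \<subseteq> A" using s by auto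
    have "mixture_weight l p n s a = l / real n * (c a + real (k s a))" for a
      unfolding mixture_weight_def k_eq c_def using n l0 by (simp add: field_simps)
    then have "(\<Prod>i<n. mixture_weight l p n s (s i)) = (\<Prod>i<n. l / real n) * (\<Prod>i<n. c (s i) + real (k s (s i)))"
      by (simp only: prod.distrib)
    also have "(\<Prod>i<n. c (s i) + real (k s (s i))) = (\<Prod>a\<in>A. (c a + real (k s a)) ^ k s a)"
      unfolding k_def by (rule prod_comp_card[OF _ A(1) im]) simp
    finally show ?thesis by simp
  qed
  \<comment> \<open>Only this total enters the Abel sum, and it does not involve
    \<open>p\<close>.\<close>
  have "sum c A = real n * (1 - l) / l"
    unfolding c_def sum_distrib_left[symmetric] using p by (simp add: simplex_on_def)
  then have "(\<Sum>s\<in>{..<n} \<rightarrow>\<^sub>E A. \<Prod>i<n. mixture_weight l p n s (s i))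
      = (l / real n) ^ n * (fact n * abel (card A - 1) (real n * (1 - l) / l) n)"
    using sum_functions_abel[OF A, of "{..<n}" c]
    by (simp add: eq k_def flip: sum_distrib_left cong: sum.cong)
  also have "\<dots> \<le> G_poly (card A) n l"
    using A n l0 by (intro abel_le_G_poly) (auto simp: Suc_le_eq card_gt_0_iff)
  finally show ?thesis .
qed

text \<open>\<open>n\<close> times the divergence is the log-likelihood ratio of the sample.
  Positivity of \<open>p\<close> at observed letters excludes the infinite branch, and unobserved
  letters contribute 0.\<close>

lemma KL_div_empirical:
  assumes A: "finite A" "s ` {..<n} \<subseteq> A" and n: "n \<ge> 1"
    and pos: "\<And>i. i < n \<Longrightarrow> p (s i) > 0"
    and ph: "\<And>a. ph a = real (card {i. i < n \<and> s i = a}) / real n"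
  shows "ereal (real n) * KL_div A ph p = ereal (\<Sum>i<n. ln (ph (s i) / p (s i)))"
proof -
  have "p a > 0" if "ph a \<noteq> 0" for a
  proof -
    have "card {i. i < n \<and> s i = a} \<noteq> 0" using that by (auto simp: ph)
    then obtain i where "i < n" "s i = a" by (auto simp: card_eq_0_iff)
    then show ?thesis using pos by auto
  qed
  then have "KL_div A ph p = (\<Sum>a\<in>A. ereal (ph a * ln (ph a / p a)))"
    unfolding KL_div_def by (intro sum.cong refl) force
  moreover have "(\<Sum>i<n. ln (ph (s i) / p (s i))) = (\<Sum>a\<in>A. real (card {i \<in> {..<n}. s i = a}) * ln (ph a / p a))"
    using A by (intro sum_comp_card) auto
  moreover have "real (card {i \<in> {..<n}. s i = a}) = real n * ph a" for a
    using n by (simp add: ph lessThan_def)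
  ultimately show ?thesis
    by (simp add: sum_distrib_left mult.assoc)
qed

text \<open>Each factor on the left is \<open>p^(1 - l) ph^l\<close>, which weighted AM-GM bounds by
  the mixture.\<close>

lemma tilted_likelihood_le:
  assumes l: "0 \<le> l" "l \<le> 1" and n: "n \<ge> 1" 
    and pos: "\<And>i. i < n \<Longrightarrow> p (s i) > 0"
    and ph: "\<And>a. ph a = real (card {i. i < n \<and> s i = a}) / real n"
  shows "(\<Prod>i<n. p (s i)) * exp (l * (\<Sum>i<n. ln (ph (s i) / p (s i)))) \<le> (\<Prod>i<n. mixture_weight l p n s (s i))"
proof -
  have "(\<Prod>i<n. p (s i)) * exp (l * (\<Sum>i<n. ln (ph (s i) / p (s i))))
      = (\<Prod>i<n. p (s i) * exp (l * ln (ph (s i) / p (s i))))"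
    by (simp add: sum_distrib_left exp_sum prod.distrib)
  also have "\<dots> \<le> (\<Prod>i<n. mixture_weight l p n s (s i))"
  proof (intro prod_mono conjI)
    fix i assume i: "i \<in> {..<n}"
    then have p: "p (s i) > 0" using pos by auto
    then show "0 \<le> p (s i) * exp (l * ln (ph (s i) / p (s i)))" by simp
    \<comment> \<open>The index \<open>i\<close> counts itself, so the frequency of an observed
      letter is positive and the logarithm of the ratio splits.\<close>
    have "i \<in> {j. j < n \<and> s j = s i}" using i by auto
    then have "card {j. j < n \<and> s j = s i} > 0" by (subst card_gt_0_iff) auto
    then have q: "ph (s i) > 0" using n by (simp add: ph)
    have "p (s i) * exp (l * ln (ph (s i) / p (s i))) = exp (ln (p (s i)) + l * ln (ph (s i) / p (s i)))"
      using p by (simp add: exp_add)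
    also have "\<dots> = p (s i) powr (1 - l) * ph (s i) powr l"
      using p q by (simp add: powr_def ln_div algebra_simps flip: exp_add)
    also have "\<dots> \<le> (1 - l) * p (s i) + l * ph (s i)"
      using l p q by (intro Youngs_inequality_0) auto
    finally show "p (s i) * exp (l * ln (ph (s i) / p (s i))) \<le> mixture_weight l p n s (s i)"
      by (simp add: mixture_weight_def ph)
  qed
  finally show ?thesis .
qed

section \<open>Independent arms and the tail bound\<close>

lemma sum_PiE_dflt_sample_index:
  fixes f :: "nat \<Rightarrow> (nat \<Rightarrow> 'a) \<Rightarrow> real"
  assumes A: "finite A"
  shows "(\<Sum>s\<in>PiE_dflt (sample_index Q n) z (\<lambda>_. A). \<Prod>q<Q. f q (\<lambda>i\<in>{..<n q}. s (q, i)))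
       = (\<Prod>q<Q. \<Sum>r\<in>{..<n q} \<rightarrow>\<^sub>E A. f q r)"
proof -
  have "(\<Prod>q<Q. \<Sum>r\<in>{..<n q} \<rightarrow>\<^sub>E A. f q r) = (\<Sum>g\<in>(\<Pi>\<^sub>E q\<in>{..<Q}. {..<n q} \<rightarrow>\<^sub>E A). \<Prod>q<Q. f q (g q))"
    using A by (intro prod_sum_PiE) (auto intro!: finite_PiE)
  \<comment> \<open>Currying: a sample indexed by pairs with value \<open>z\<close> off the index
    set corresponds to a family of extensional samples, one per arm.\<close>
  also have "\<dots> = (\<Sum>s\<in>PiE_dflt (sample_index Q n) z (\<lambda>_. A). \<Prod>q<Q. f q (\<lambda>i\<in>{..<n q}. s (q, i)))"
  proof (rule sum.reindex_bij_witness[where j = "\<lambda>g x. if x \<in> sample_index Q n then g (fst x) (snd x) else z"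
      and i = "\<lambda>s. \<lambda>q\<in>{..<Q}. \<lambda>i\<in>{..<n q}. s (q, i)"], goal_cases)
    case (1 g)
    show ?case
    proof
      fix q
      show "(\<lambda>q\<in>{..<Q}. \<lambda>i\<in>{..<n q}. if (q, i) \<in> sample_index Q n then g (fst (q, i)) (snd (q, i)) else z) q = g q"
      proof (cases "q < Q")
        case True
        then have "g q \<in> {..<n q} \<rightarrow>\<^sub>E A" using 1 by auto
        then show ?thesis using True
          by (auto simp: sample_index_def fun_eq_iff PiE_iff extensional_def)
      next
        case False
        then show ?thesis using PiE_arb[OF 1, of q] by simp
      qed
    qed
  next
    case (2 g)
    then show ?case by (fastforce simp: PiE_dflt_def sample_index_def PiE_iff)
  next
    case (3 s)
    then show ?case by (auto simp: PiE_dflt_def sample_index_def fun_eq_iff)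
  next
    case (4 s)
    then show ?case by (auto simp: PiE_dflt_def sample_index_def)
  next
    case (5 g)
    have "(\<lambda>i\<in>{..<n q}. if (q, i) \<in> sample_index Q n then g (fst (q, i)) (snd (q, i)) else z) = g q" if "q < Q" for q
    proof -
      have "g q \<in> {..<n q} \<rightarrow>\<^sub>E A" using 5 that by auto
      then show ?thesis using that by (auto simp: sample_index_def fun_eq_iff PiE_iff extensional_def)
    qed
    then show ?case by (intro prod.cong refl) (auto intro!: arg_cong[where f = "f _"])
  qed
  finally show ?thesis by simp
qed

lemma finite_sample_index: "finite (sample_index Q n)"
proof -
  have "sample_index Q n = (SIGMA q:{..<Q}. {..<n q})" by (auto simp: sample_index_def)
  then show ?thesis by simp
qed

text \<open>Exponential Markov inequality for a fixed \<open>l\<close>, carried out point by point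
  on the finite support; the resulting bound then factors over the arms.\<close>

lemma empirical_KL_tail:
  fixes A :: "(nat \<times> nat) set" and D :: "nat \<Rightarrow> (nat \<times> nat) pmf"
  assumes A: "finite A" "A \<noteq> {}" and D: "\<And>q. q < Q \<Longrightarrow> set_pmf (D q) \<subseteq> A"
    and n: "\<And>q. q < Q \<Longrightarrow> n q \<ge> 1" and l: "0 \<le> l" "l \<le> 1"
  shows "measure_pmf.prob (Pi_pmf (sample_index Q n) z (\<lambda>(q, i). D q))
           {s. \<not> (\<Sum>q<Q. ereal (real (n q)) * KL_div A (emp_dist n s q) (pmf (D q))) \<le> ereal t}
         \<le> exp (- l * t) * (\<Prod>q<Q. G_poly (card A) (n q) l)"
proof -
  define P where "P = Pi_pmf (sample_index Q n) z (\<lambda>(q, i). D q)"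
  define bad where "bad = {s. \<not> (\<Sum>q<Q. ereal (real (n q)) * KL_div A (emp_dist n s q) (pmf (D q))) \<le> ereal t}"
  define T where "T = PiE_dflt (sample_index Q n) z (\<lambda>_. A)"
  define W where "W q r = (\<Prod>i<n q. mixture_weight l (pmf (D q)) (n q) r (r i))" for q r
  have W_nonneg: "0 \<le> W q r" for q r
    unfolding W_def mixture_weight_def using l by (intro prod_nonneg) auto
  have T: "finite T"
    unfolding T_def using A finite_sample_index by (intro finite_PiE_dflt) auto
  have supp: "set_pmf P = PiE_dflt (sample_index Q n) z (set_pmf \<circ> (\<lambda>(q, i). D q))"
    unfolding P_def by (rule set_Pi_pmf[OF finite_sample_index])
  have supp_T: "set_pmf P \<subseteq> T"
    unfolding supp T_def using D by (fastforce simp: PiE_dflt_def sample_index_def)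
  have term_le: "pmf P s \<le> exp (- l * t) * (\<Prod>q<Q. W q (\<lambda>i\<in>{..<n q}. s (q, i)))"
    if s: "s \<in> bad" "s \<in> set_pmf P" for s
  proof -
    \<comment> \<open>Restriction makes the sample of each arm extensional; \<open>emp_dist\<close>
      reads only indices below \<open>n q\<close>, so the frequencies are unchanged.\<close>
    define r where "r q = (\<lambda>i\<in>{..<n q}. s (q, i))" for q
    define L where "L q = (\<Sum>i<n q. ln (emp_dist n s q (r q i) / pmf (D q) (r q i)))" for q
    have sA: "s (q, i) \<in> set_pmf (D q)" if "q < Q" "i < n q" for q i
      using s(2) that unfolding supp by (force simp: PiE_dflt_def sample_index_def)
    have pos: "pmf (D q) (r q i) > 0" if "q < Q" "i < n q" for q i
      using sA[OF that] that by (simp add: r_def pmf_positive)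
    have ph: "emp_dist n s q a = real (card {i. i < n q \<and> r q i = a}) / real (n q)" for q a
      unfolding emp_dist_def r_def by (intro arg_cong2[where f = "(/)"] arg_cong[where f = real] arg_cong[where f = card]) auto
    have im: "r q ` {..<n q} \<subseteq> A" if "q < Q" for q
      by (auto simp: r_def intro!: subsetD[OF D[OF that]] sA that)
    have "ereal (real (n q)) * KL_div A (emp_dist n s q) (pmf (D q)) = ereal (L q)" if "q < Q" for q
      unfolding L_def using that by (intro KL_div_empirical A im n pos ph)
    then have "(\<Sum>q<Q. ereal (real (n q)) * KL_div A (emp_dist n s q) (pmf (D q))) = ereal (\<Sum>q<Q. L q)"
      by simp
    then have tL: "t \<le> (\<Sum>q<Q. L q)" using s(1) by (simp add: bad_def)
    have "pmf P s = (\<Prod>x\<in>sample_index Q n. pmf (D (fst x)) (s x))"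
      unfolding P_def using s(2) unfolding supp
      by (subst pmf_Pi') (auto simp: finite_sample_index PiE_dflt_def split_beta)
    also have "sample_index Q n = (SIGMA q:{..<Q}. {..<n q})" by (auto simp: sample_index_def)
    also have "(\<Prod>x\<in>(SIGMA q:{..<Q}. {..<n q}). pmf (D (fst x)) (s x)) = (\<Prod>q<Q. \<Prod>i<n q. pmf (D q) (r q i))"
      by (subst prod.Sigma) (auto simp: r_def split_beta intro!: prod.cong)
    \<comment> \<open>The Markov step: on \<open>bad\<close> the total log-likelihood ratio is at
      least \<open>t\<close>, so the inserted exponential is at least 1.\<close>
    also have "\<dots> \<le> (\<Prod>q<Q. \<Prod>i<n q. pmf (D q) (r q i)) * exp (l * ((\<Sum>q<Q. L q) - t))"
    proof -
      have "1 \<le> exp (l * ((\<Sum>q<Q. L q) - t))" using tL l by simp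
      then show ?thesis
        using mult_left_mono[of 1 _ "\<Prod>q<Q. \<Prod>i<n q. pmf (D q) (r q i)"] by (simp add: prod_nonneg)
    qed
    also have "\<dots> = exp (- l * t) * (\<Prod>q<Q. (\<Prod>i<n q. pmf (D q) (r q i)) * exp (l * L q))"
      by (simp add: prod.distrib right_diff_distrib sum_distrib_left exp_diff exp_sum exp_minus field_simps)
    also have "\<dots> \<le> exp (- l * t) * (\<Prod>q<Q. W q (r q))"
      unfolding W_def L_def using l n pos ph
      by (intro mult_left_mono prod_mono conjI tilted_likelihood_le) (auto intro!: mult_nonneg_nonneg prod_nonneg)
    finally show ?thesis by (simp add: r_def)
  qed
  have "measure_pmf.prob P bad = measure_pmf.prob P (bad \<inter> set_pmf P)"
    by (simp add: measure_Int_set_pmf)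
  also have "\<dots> = (\<Sum>s\<in>bad \<inter> set_pmf P. pmf P s)"
    using T supp_T by (intro measure_measure_pmf_finite) (auto intro: finite_subset)
  also have "\<dots> \<le> (\<Sum>s\<in>bad \<inter> set_pmf P. exp (- l * t) * (\<Prod>q<Q. W q (\<lambda>i\<in>{..<n q}. s (q, i))))"
    by (intro sum_mono term_le) auto
  \<comment> \<open>The weights are nonnegative, so the sum may grow from the bad event to the full
    product set, where it factors.\<close>
  also have "\<dots> \<le> (\<Sum>s\<in>T. exp (- l * t) * (\<Prod>q<Q. W q (\<lambda>i\<in>{..<n q}. s (q, i))))"
    using T supp_T W_nonneg by (intro sum_mono2) (auto intro!: mult_nonneg_nonneg prod_nonneg)
  also have "\<dots> = exp (- l * t) * (\<Prod>q<Q. \<Sum>r\<in>{..<n q} \<rightarrow>\<^sub>E A. W q r)"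
    unfolding T_def sum_distrib_left[symmetric] by (subst sum_PiE_dflt_sample_index[OF A(1)]) simp
  also have "\<dots> \<le> exp (- l * t) * (\<Prod>q<Q. G_poly (card A) (n q) l)"
  proof (intro mult_left_mono prod_mono conjI)
    fix q assume "q \<in> {..<Q}"
    then have "simplex_on A (pmf (D q))" using D[of q] A by (simp add: simplex_on_def sum_pmf_eq_1)
    then show "(\<Sum>r\<in>{..<n q} \<rightarrow>\<^sub>E A. W q r) \<le> G_poly (card A) (n q) l"
      unfolding W_def using A n l \<open>q \<in> {..<Q}\<close> by (intro sum_mixture_weight_le_G_poly) auto
  qed (auto intro!: sum_nonneg W_nonneg)
  finally show ?thesis unfolding P_def bad_def .
qed

section \<open>The instrumental inequalities\<close>

lemma (in prob_space) indep_rv_prob: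
  assumes "indep_rv M Ma A Mb B" "S \<in> sets Ma" "T \<in> sets Mb"
  shows "prob {w \<in> space M. A w \<in> S \<and> B w \<in> T}
       = prob {w \<in> space M. A w \<in> S} * prob {w \<in> space M. B w \<in> T}"
proof -
  have "prob ((A -` S \<inter> space M) \<inter> (B -` T \<inter> space M)) = prob (A -` S \<inter> space M) * prob (B -` T \<inter> space M)"
    using assms unfolding indep_rv_def by (intro indep_setD) auto
  moreover have "(A -` S \<inter> space M) \<inter> (B -` T \<inter> space M) = {w \<in> space M. A w \<in> S \<and> B w \<in> T}"
    "A -` S \<inter> space M = {w \<in> space M. A w \<in> S}" "B -` T \<inter> space M = {w \<in> space M. B w \<in> T}"
    by auto
  ultimately show ?thesis by simp
qed

text \<open>The part of the setting shared by the five models. Exclusion and independence enter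
  lemma by lemma.\<close>

locale iv_data = prob_space Mp for Mp :: "'w measure" +
  fixes K M Q :: nat and X Y Z :: "'w \<Rightarrow> nat" and Yp :: "nat \<Rightarrow> nat \<Rightarrow> 'w \<Rightarrow> nat"
  assumes Z_meas: "Z \<in> measurable Mp cnt" and X_meas: "X \<in> measurable Mp cnt"
    and Y_meas: "Y \<in> measurable Mp cnt"
    and Yp_meas: "\<And>k q. k < K \<Longrightarrow> q < Q \<Longrightarrow> Yp k q \<in> measurable Mp cnt"
    and obs_range: "\<And>w. w \<in> space Mp \<Longrightarrow> Z w < Q \<and> X w < K \<and> Y w < M"
    and Yp_range: "\<And>w k q. w \<in> space Mp \<Longrightarrow> k < K \<Longrightarrow> q < Q \<Longrightarrow> Yp k q w < M"
    and consistency: "AE w in Mp. Y w = Yp (X w) (Z w) w"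
    and Z_pos: "\<And>q. q < Q \<Longrightarrow> measure Mp {w\<in>space Mp. Z w = q} > 0"
begin

definition joint :: "nat \<Rightarrow> (nat \<Rightarrow> nat set) \<Rightarrow> 'w set" where
  "joint q V = {w \<in> space Mp. \<forall>k<K. Yp k q w \<in> V k}"

text \<open>The event measured by \<open>P0\<close>. It uses the realised instrument, in contrast to
  \<open>joint q V\<close>; exclusion links the two.\<close>

definition target :: "(nat \<Rightarrow> nat set) \<Rightarrow> 'w set" where
  "target V = {w \<in> space Mp. \<forall>k<K. Yp k (Z w) w \<in> V k}"

lemma cnt_event:
  assumes "f \<in> measurable Mp cnt" shows "{w \<in> space Mp. f w \<in> S} \<in> events"
proof -
  have "f -` S \<inter> space Mp \<in> events" using assms by (rule measurable_sets) simp
  moreover have "f -` S \<inter> space Mp = {w \<in> space Mp. f w \<in> S}" by auto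
  ultimately show ?thesis by simp
qed

lemma Z_event: "{w \<in> space Mp. Z w = q} \<in> events"
  using cnt_event[OF Z_meas, of "{q}"] by simp

lemma X_event: "{w \<in> space Mp. X w = k} \<in> events"
  using cnt_event[OF X_meas, of "{k}"] by simp

lemma XZ_event: "{w \<in> space Mp. X w = k \<and> Z w = q} \<in> events"
  by (rule sets.sets_Collect_conj[OF Z_event X_event])

lemma Yp_event: "k < K \<Longrightarrow> q < Q \<Longrightarrow> {w \<in> space Mp. Yp k q w \<in> S} \<in> events"
  by (rule cnt_event[OF Yp_meas])

lemma joint_event: "q < Q \<Longrightarrow> joint q V \<in> events"
proof -
  assume "q < Q"
  then have "{w \<in> space Mp. \<forall>k\<in>{..<K}. Yp k q w \<in> V k} \<in> events"
    by (intro sets.sets_Collect_finite_All Yp_event) auto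
  moreover have "{w \<in> space Mp. \<forall>k\<in>{..<K}. Yp k q w \<in> V k} = joint q V"
    by (auto simp: joint_def)
  ultimately show ?thesis by simp
qed

lemma target_eq: "target V = (\<Union>q<Q. {w \<in> space Mp. Z w = q} \<inter> joint q V)"
  using obs_range by (auto simp: target_def joint_def)

lemma target_event: "target V \<in> events"
  unfolding target_eq using Z_event joint_event by auto

lemma prob_target: "prob (target V) = (\<Sum>q<Q. prob ({w \<in> space Mp. Z w = q} \<inter> joint q V))"
  unfolding target_eq using Z_event joint_event
  by (intro finite_measure_finite_Union) (auto simp: disjoint_family_on_def)

lemma sum_prob_Z: "(\<Sum>q<Q. prob {w \<in> space Mp. Z w = q}) = 1"
proof -
  have "(\<Sum>q<Q. prob {w \<in> space Mp. Z w = q}) = prob (\<Union>q<Q. {w \<in> space Mp. Z w = q})"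
    using Z_event by (intro finite_measure_finite_Union[symmetric]) (auto simp: disjoint_family_on_def)
  also have "(\<Union>q<Q. {w \<in> space Mp. Z w = q}) = space Mp" using obs_range by auto
  finally show ?thesis by (simp add: prob_space)
qed

text \<open>Where \<open>X = k\<close> and \<open>Z = q\<close>, consistency identifies
  \<open>Y\<close> with \<open>Yp k q\<close> almost everywhere.\<close>

lemma prob_observed:
  assumes "k < K" "q < Q"
  shows "prob {w \<in> space Mp. X w = k \<and> Y w \<in> S \<and> Z w = q}
       = prob ({w \<in> space Mp. Yp k q w \<in> S} \<inter> {w \<in> space Mp. X w = k \<and> Z w = q})"
proof (rule finite_measure_eq_AE)
  show "AE w in Mp. (w \<in> {w \<in> space Mp. X w = k \<and> Y w \<in> S \<and> Z w = q})
      = (w \<in> {w \<in> space Mp. Yp k q w \<in> S} \<inter> {w \<in> space Mp. X w = k \<and> Z w = q})"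
    using consistency by eventually_elim auto
  show "{w \<in> space Mp. X w = k \<and> Y w \<in> S \<and> Z w = q} \<in> events"
    by (intro sets.sets_Collect_conj X_event Z_event cnt_event Y_meas)
  show "{w \<in> space Mp. Yp k q w \<in> S} \<inter> {w \<in> space Mp. X w = k \<and> Z w = q} \<in> events"
    using assms by (intro sets.Int Yp_event XZ_event)
qed

section \<open>The row inequality under each model, with the denominator \<open>P(Z = q)\<close>
  cleared\<close>

definition iv_ineq :: "(nat \<Rightarrow> nat set) \<Rightarrow> nat \<Rightarrow> bool" where
  "iv_ineq V q \<longleftrightarrow> prob (target V) * prob {w \<in> space Mp. Z w = q}
     \<le> (\<Sum>k<K. prob {w \<in> space Mp. X w = k \<and> Y w \<in> V k \<and> Z w = q})"

text \<open>Independence writes the probability of the target as an average over instrument values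
  of the \<open>joint\<close> probabilities, which agree by \<open>ex\<close>. Both
  \<open>E1\<close> and \<open>E2\<close> supply that premise.\<close>

lemma iv_ineq_of_I2:
  assumes I2: "I2 Mp K Q Z Yp"
    and ex: "\<And>q'. q' < Q \<Longrightarrow> prob (joint q' V) = prob (joint q V)" and q: "q < Q"
  shows "iv_ineq V q"
proof -
  have indep: "prob ({w \<in> space Mp. Z w = q'} \<inter> joint q' V)
      = prob {w \<in> space Mp. Z w = q'} * prob (joint q' V)" if "q' < Q" for q'
  proof -
    define T where "T = {f \<in> space (Yfam_space K Q). \<forall>k\<in>{..<K}. f (k, q') \<in> V k}"
    have comp: "(\<lambda>f. f (k, q')) \<in> measurable (Yfam_space K Q) cnt" if "k < K" for k
      unfolding Yfam_space_def using that \<open>q' < Q\<close> by (intro measurable_component_singleton) auto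
    have "T \<in> sets (Yfam_space K Q)"
      unfolding T_def
    proof (intro sets.sets_Collect_finite_All)
      fix k assume "k \<in> {..<K}"
      then have "(\<lambda>f. f (k, q')) -` V k \<inter> space (Yfam_space K Q) \<in> sets (Yfam_space K Q)"
        by (intro measurable_sets[OF comp]) auto
      moreover have "(\<lambda>f. f (k, q')) -` V k \<inter> space (Yfam_space K Q) = {f \<in> space (Yfam_space K Q). f (k, q') \<in> V k}"
        by auto
      ultimately show "{f \<in> space (Yfam_space K Q). f (k, q') \<in> V k} \<in> sets (Yfam_space K Q)" by simp
    qed simp
    moreover have "Yfam K Q Yp w \<in> T \<longleftrightarrow> (\<forall>k<K. Yp k q' w \<in> V k)" for w
      using \<open>q' < Q\<close> by (auto simp: T_def Yfam_def Yfam_space_def space_PiM)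
    ultimately show ?thesis
      using indep_rv_prob[OF I2[unfolded I2_def], of "{q'}" T] by (simp add: joint_def Collect_conj_eq[symmetric] Int_def conj_ac)
  qed
  have "prob (target V) = (\<Sum>q'<Q. prob {w \<in> space Mp. Z w = q'} * prob (joint q V))"
    unfolding prob_target by (intro sum.cong refl) (simp add: indep ex)
  also have "\<dots> = prob (joint q V)" by (simp add: sum_prob_Z flip: sum_distrib_right)
  finally have "prob (target V) * prob {w \<in> space Mp. Z w = q} = prob ({w \<in> space Mp. Z w = q} \<inter> joint q V)"
    using q by (simp add: indep)
  \<comment> \<open>On \<open>Z = q\<close> the observed \<open>X\<close> is some
    \<open>k < K\<close>, and only the coordinate of that \<open>k\<close> is kept.\<close>
  also have "\<dots> \<le> prob (\<Union>k<K. {w \<in> space Mp. Yp k q w \<in> V k} \<inter> {w \<in> space Mp. X w = k \<and> Z w = q})"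
    using obs_range q by (intro finite_measure_mono sets.finite_UN sets.Int Yp_event XZ_event) (auto simp: joint_def)
  also have "\<dots> \<le> (\<Sum>k<K. prob ({w \<in> space Mp. Yp k q w \<in> V k} \<inter> {w \<in> space Mp. X w = k \<and> Z w = q}))"
    using q Yp_event XZ_event by (intro finite_measure_subadditive_finite) auto
  also have "\<dots> = (\<Sum>k<K. prob {w \<in> space Mp. X w = k \<and> Y w \<in> V k \<and> Z w = q})"
    using q by (simp add: prob_observed)
  finally show ?thesis unfolding iv_ineq_def .
qed

lemma joint_prob_eq_of_E1:
  assumes "E1 Mp K Q Yp" "q < Q" "q' < Q"
  shows "prob (joint q' V) = prob (joint q V)"
proof (rule finite_measure_eq_AE)
  have "AE w in Mp. \<forall>k\<in>{..<K}. Yp k q w = Yp k q' w"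
    using assms by (intro AE_finite_allI) (auto simp: E1_def)
  then show "AE w in Mp. (w \<in> joint q' V) = (w \<in> joint q V)"
    by eventually_elim (auto simp: joint_def)
qed (intro joint_event assms)+

lemma joint_prob_eq_of_E2:
  assumes "E2 Mp K Q Yp" "q < Q" "q' < Q"
  shows "prob (joint q' V) = prob (joint q V)"
proof -
  define N :: "(nat \<Rightarrow> nat) measure" where "N = PiM {..<K} (\<lambda>_. cnt)"
  define T where "T = {f \<in> space N. \<forall>k\<in>{..<K}. f k \<in> V k}"
  have T: "T \<in> sets N"
    unfolding T_def
  proof (intro sets.sets_Collect_finite_All)
    fix k assume "k \<in> {..<K}"
    then have "(\<lambda>f. f k) -` V k \<inter> space N \<in> sets N"
      unfolding N_def by (intro measurable_sets[OF measurable_component_singleton]) auto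
    moreover have "(\<lambda>f. f k) -` V k \<inter> space N = {f \<in> space N. f k \<in> V k}" by auto
    ultimately show "{f \<in> space N. f k \<in> V k} \<in> sets N" by simp
  qed simp
  have "measure (distr Mp N (\<lambda>w. restrict (\<lambda>k. Yp k r w) {..<K})) T = prob (joint r V)" if "r < Q" for r
  proof -
    have "(\<lambda>w. restrict (\<lambda>k. Yp k r w) {..<K}) \<in> measurable Mp N"
      unfolding N_def using that Yp_meas by (intro measurable_restrict) auto
    then have "measure (distr Mp N (\<lambda>w. restrict (\<lambda>k. Yp k r w) {..<K})) T
        = prob ((\<lambda>w. restrict (\<lambda>k. Yp k r w) {..<K}) -` T \<inter> space Mp)"
      by (rule measure_distr[OF _ T])
    also have "(\<lambda>w. restrict (\<lambda>k. Yp k r w) {..<K}) -` T \<inter> space Mp = joint r V"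
      by (auto simp: T_def N_def joint_def space_PiM)
    finally show ?thesis .
  qed
  moreover have "distr Mp N (\<lambda>w. restrict (\<lambda>k. Yp k q' w) {..<K}) = distr Mp N (\<lambda>w. restrict (\<lambda>k. Yp k q w) {..<K})"
    using assms unfolding E2_def N_def by blast
  ultimately show ?thesis using assms(2,3) by metis
qed

text \<open>Here \<open>Z\<close> is independent only of single pairs
  \<open>(X(q), Y(k, q))\<close>, so the joint event cannot be factored as before. The union bound
  over the potential exposure comes first, and each pair event is factored afterwards.\<close>

lemma iv_ineq_of_I3:
  assumes E1: "E1 Mp K Q Yp" and I3: "I3 Mp K Q Z Yp Xp" and consX: "consX Mp X Z Xp" and q: "q < Q"
    and Xp_meas: "Xp q \<in> measurable Mp cnt"
    and Xp_range: "\<And>w. w \<in> space Mp \<Longrightarrow> Xp q w < K"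
  shows "iv_ineq V q"
proof -
  define B where "B k = {w \<in> space Mp. (Xp q w, Yp k q w) \<in> {k} \<times> V k}" for k
  have B: "B k \<in> events" if "k < K" for k
    using sets.sets_Collect_conj[OF Yp_event[OF that q, of "V k"] cnt_event[OF Xp_meas, of "{k}"]]
    by (simp add: B_def)
  have "AE w in Mp. \<forall>k\<in>{..<K}. \<forall>q'\<in>{..<Q}. Yp k q w = Yp k q' w"
    using assms by (intro AE_finite_allI) (auto simp: E1_def)
  with AE_space have "AE w in Mp. (w \<in> target V) = (w \<in> joint q V)"
  proof eventually_elim
    case (elim w)
    then have "\<forall>k<K. Yp k (Z w) w = Yp k q w" using obs_range[of w] by auto
    then show ?case by (auto simp: joint_def target_def)
  qed
  then have "prob (target V) = prob (joint q V)"
    using q by (intro finite_measure_eq_AE target_event joint_event)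
  \<comment> \<open>The witness for \<open>k\<close> is \<open>Xp q w\<close>, which lies below
    \<open>K\<close>.\<close>
  also have "\<dots> \<le> prob (\<Union>k<K. B k)"
    using Xp_range q B by (intro finite_measure_mono sets.finite_UN) (auto simp: joint_def B_def)
  also have "\<dots> \<le> (\<Sum>k<K. prob (B k))"
    using B by (intro finite_measure_subadditive_finite) auto
  finally have "prob (target V) * prob {w \<in> space Mp. Z w = q} \<le> (\<Sum>k<K. prob (B k)) * prob {w \<in> space Mp. Z w = q}"
    by (intro mult_right_mono) auto
  also have "\<dots> = (\<Sum>k<K. prob {w \<in> space Mp. X w = k \<and> Y w \<in> V k \<and> Z w = q})"
    unfolding sum_distrib_right
  proof (intro sum.cong refl)
    fix k assume "k \<in> {..<K}"
    then have k: "k < K" by simp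
    have ind: "indep_rv Mp cnt Z (cnt \<Otimes>\<^sub>M cnt) (\<lambda>w. (Xp q w, Yp k q w))"
      using I3 k q unfolding I3_def by blast
    have "prob {w \<in> space Mp. Z w \<in> {q} \<and> (Xp q w, Yp k q w) \<in> {k} \<times> V k}
        = prob {w \<in> space Mp. Z w \<in> {q}} * prob (B k)"
      unfolding B_def by (rule indep_rv_prob[OF ind]) (auto intro: pair_measureI)
    then have "prob (B k) * prob {w \<in> space Mp. Z w = q} = prob ({w \<in> space Mp. Z w = q} \<inter> B k)"
      by (simp add: B_def Int_def conj_ac)
    also have "\<dots> = prob ({w \<in> space Mp. Yp k q w \<in> V k} \<inter> {w \<in> space Mp. X w = k \<and> Z w = q})"
    proof (rule finite_measure_eq_AE)
      show "AE w in Mp. (w \<in> {w \<in> space Mp. Z w = q} \<inter> B k)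
          = (w \<in> {w \<in> space Mp. Yp k q w \<in> V k} \<inter> {w \<in> space Mp. X w = k \<and> Z w = q})"
        using consX unfolding consX_def by eventually_elim (auto simp: B_def)
    qed (intro sets.Int Z_event B k q Yp_event XZ_event)+
    finally show "prob (B k) * prob {w \<in> space Mp. Z w = q} = prob {w \<in> space Mp. X w = k \<and> Y w \<in> V k \<and> Z w = q}"
      using k q by (simp add: prob_observed)
  qed
  finally show ?thesis unfolding iv_ineq_def .
qed

lemma I2_of_I1:
  fixes Xp :: "nat \<Rightarrow> 'w \<Rightarrow> nat"
  assumes "I1 Mp K Q Z Yp Xp"
  shows "I2 Mp K Q Z Yp"
proof -
  let ?N = "PiM {..<Q} (\<lambda>_. cnt) :: (nat \<Rightarrow> nat) measure"
  let ?f = "\<lambda>w. (Yfam K Q Yp w, restrict (\<lambda>q. Xp q w) {..<Q})"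
  have Zm: "Z \<in> measurable Mp cnt" and fm: "?f \<in> measurable Mp (Yfam_space K Q \<Otimes>\<^sub>M ?N)"
    and ind: "indep_set {Z -` S \<inter> space Mp | S. S \<in> sets cnt} {?f -` S \<inter> space Mp | S. S \<in> sets (Yfam_space K Q \<Otimes>\<^sub>M ?N)}"
    using assms by (auto simp: I1_def indep_rv_def)
  have Ym: "Yfam K Q Yp \<in> measurable Mp (Yfam_space K Q)"
    using measurable_compose[OF fm measurable_fst] by simp
  have sub: "{Yfam K Q Yp -` S \<inter> space Mp | S. S \<in> sets (Yfam_space K Q)}
      \<subseteq> {?f -` S \<inter> space Mp | S. S \<in> sets (Yfam_space K Q \<Otimes>\<^sub>M ?N)}"
  proof clarify
    fix S assume S: "S \<in> sets (Yfam_space K Q)"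
    then have "Yfam K Q Yp -` S \<inter> space Mp = ?f -` (S \<times> space ?N) \<inter> space Mp"
      by (auto simp: space_PiM)
    moreover have "S \<times> space ?N \<in> sets (Yfam_space K Q \<Otimes>\<^sub>M ?N)" using S by auto
    ultimately show "\<exists>S'. Yfam K Q Yp -` S \<inter> space Mp = ?f -` S' \<inter> space Mp \<and> S' \<in> sets (Yfam_space K Q \<Otimes>\<^sub>M ?N)"
      by blast
  qed
  have "indep_set {Z -` S \<inter> space Mp | S. S \<in> sets cnt} {Yfam K Q Yp -` S \<inter> space Mp | S. S \<in> sets (Yfam_space K Q)}"
    unfolding indep_set_def
  proof (rule indep_sets_mono_sets[OF ind[unfolded indep_set_def]])
    fix b :: bool
    show "case_bool {Z -` S \<inter> space Mp | S. S \<in> sets cnt} {Yfam K Q Yp -` S \<inter> space Mp | S. S \<in> sets (Yfam_space K Q)} b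
      \<subseteq> case_bool {Z -` S \<inter> space Mp | S. S \<in> sets cnt} {?f -` S \<inter> space Mp | S. S \<in> sets (Yfam_space K Q \<Otimes>\<^sub>M ?N)} b"
      by (cases b) (simp_all only: bool.case sub order.refl)
  qed
  with Zm Ym show ?thesis unfolding I2_def indep_rv_def by blast
qed

text \<open>Given \<open>U\<close>, the target has at most the probability of each single coordinate
  event. Multiplying by \<open>P(X = k, Z = q | U)\<close>, using conditional independence, summing
  over \<open>k\<close> and integrating gives the claim.\<close>

lemma iv_ineq_of_I4:
  assumes E3: "E3 Mp K Q Yp U MU" and I4: "I4 Mp K Q X Z Yp U MU"
    and U: "U \<in> measurable Mp MU" and q: "q < Q"
  shows "iv_ineq V q"
proof -
  define F where "F = sigma_of Mp U MU"
  have subalg: "subalgebra Mp F"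
    unfolding subalgebra_def F_def sigma_of_def
    using sets_image_in_sets[OF refl U] by simp
  interpret F: finite_measure_subalgebra Mp F
    by unfold_locales (rule subalg)
  define YE where "YE k r = {w \<in> space Mp. Yp k r w \<in> V k}" for k r
  define XZ where "XZ k = {w \<in> space Mp. X w = k \<and> Z w = q}" for k
  define ZE where "ZE r = {w \<in> space Mp. Z w = r}" for r
  define P where "P = cprob Mp F"
  have YE: "YE k r \<in> events" if "k < K" "r < Q" for k r
    using that by (simp add: YE_def Yp_event)
  have XZ: "XZ k \<in> events" for k by (simp add: XZ_def XZ_event)
  have ZE: "ZE r \<in> events" for r by (simp add: ZE_def Z_event)
  have ind_int: "integrable Mp (indicator A :: 'w \<Rightarrow> real)" if "A \<in> events" for A
    using that by (intro integrable_real_indicator) (auto simp: emeasure_eq_measure)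
  have P_int: "integrable Mp (P A)" "(\<integral>w. P A w \<partial>Mp) = prob A" if "A \<in> events" for A
    using F.real_cond_exp_int[OF ind_int[OF that]] that by (simp_all add: P_def cprob_def)
  have P_nonneg: "AE w in Mp. 0 \<le> P A w" if "A \<in> events" for A
    unfolding P_def cprob_def using that by (intro F.real_cond_exp_pos) auto
  have P_mono: "AE w in Mp. P A w \<le> P B w" if "A \<subseteq> B" "A \<in> events" "B \<in> events" for A B
    unfolding P_def cprob_def using that
    by (intro F.real_cond_exp_mono ind_int) (auto simp: indicator_def)
  have P_UN: "AE w in Mp. P (\<Union>i<m. A i) w = (\<Sum>i<m. P (A i) w)"
    if "\<And>i. i < m \<Longrightarrow> A i \<in> events" "disjoint_family_on A {..<m}" for A and m :: nat
  proof -
    \<comment> \<open>Padding with the empty set makes the indicators integrable for every index,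
      not only for \<open>i < m\<close>.\<close>
    define A' where "A' i = (if i < m then A i else {})" for i
    have "AE w in Mp. real_cond_exp Mp F (\<lambda>w. \<Sum>i<m. indicator (A' i) w) w
        = (\<Sum>i<m. real_cond_exp Mp F (indicator (A' i)) w)"
      using that by (intro F.real_cond_exp_sum ind_int) (auto simp: A'_def)
    moreover have "(\<lambda>w. \<Sum>i<m. indicator (A' i) w :: real) = indicator (\<Union>i<m. A i)"
      by (auto simp: A'_def fun_eq_iff indicator_UN_disjoint[OF finite_lessThan that(2)])
    ultimately show ?thesis by (simp add: P_def cprob_def A'_def)
  qed
  have CI: "AE w in Mp. P (YE k r \<inter> {w \<in> space Mp. (X w, Z w) \<in> B}) w
      = P (YE k r) w * P {w \<in> space Mp. (X w, Z w) \<in> B} w" if "k < K" "r < Q" for k r B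
    using I4 that unfolding I4_def cond_indep_def P_def F_def YE_def by blast
  have CI_Z: "AE w in Mp. P (YE k r \<inter> ZE r) w = P (YE k r) w * P (ZE r) w" if "k < K" "r < Q" for k r
    using CI[OF that, of "UNIV \<times> {r}"] by (simp add: ZE_def)
  have CI_XZ: "AE w in Mp. P (YE k q \<inter> XZ k) w = P (YE k q) w * P (XZ k) w" if "k < K" for k
    using CI[OF that q, of "{(k, q)}"] by (simp add: XZ_def)
  have PY: "AE w in Mp. P (YE k r) w = P (YE k q) w" if "k < K" "r < Q" for k r
    using E3 that q unfolding E3_def P_def F_def YE_def by blast
  have PZ1: "AE w in Mp. (\<Sum>r<Q. P (ZE r) w) = 1"
  proof -
    have "(\<Union>r<Q. ZE r) = space Mp" using obs_range by (auto simp: ZE_def)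
    moreover have "AE w in Mp. P (\<Union>r<Q. ZE r) w = (\<Sum>r<Q. P (ZE r) w)"
      by (rule P_UN) (use ZE in \<open>auto simp: disjoint_family_on_def ZE_def\<close>)
    moreover have "AE w in Mp. P (space Mp) w = 1"
    proof -
      have "AE w in Mp. real_cond_exp Mp F (indicator (space Mp)) w = indicator (space Mp) w"
        using subalg sets.top[of F]
        by (intro F.real_cond_exp_F_meas ind_int borel_measurable_indicator) (simp_all add: subalgebra_def)
      then show ?thesis by (auto simp: P_def cprob_def)
    qed
    ultimately show ?thesis by auto
  qed
  \<comment> \<open>The target is split over \<open>Z = r\<close> and only coordinate
    \<open>k\<close> is kept. Conditional independence and \<open>E3\<close> turn each piece into
    \<open>P (YE k q)\<close> times \<open>P (ZE r)\<close>, and the latter factors sum to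
    1.\<close>
  have target_le: "AE w in Mp. P (target V) w \<le> P (YE k q) w" if k: "k < K" for k
  proof -
    have ev: "YE k r \<inter> ZE r \<in> events" if "r < Q" for r using YE ZE k that by auto
    have 1: "AE w in Mp. P (target V) w \<le> P (\<Union>r<Q. YE k r \<inter> ZE r) w"
      using k obs_range ev by (intro P_mono target_event sets.finite_UN) (auto simp: target_def YE_def ZE_def)
    have 2: "AE w in Mp. P (\<Union>r<Q. YE k r \<inter> ZE r) w = (\<Sum>r<Q. P (YE k r \<inter> ZE r) w)"
      by (rule P_UN) (use ev in \<open>auto simp: disjoint_family_on_def ZE_def\<close>)
    have 3: "AE w in Mp. \<forall>r\<in>{..<Q}. P (YE k r \<inter> ZE r) w = P (YE k q) w * P (ZE r) w"
    proof (rule AE_finite_allI)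
      fix r assume "r \<in> {..<Q}"
      then show "AE w in Mp. P (YE k r \<inter> ZE r) w = P (YE k q) w * P (ZE r) w"
        using CI_Z[OF k, of r] PY[OF k, of r] by auto
    qed simp
    show ?thesis using 1 2 3 PZ1
    proof eventually_elim
      case (elim w)
      have "P (target V) w \<le> (\<Sum>r<Q. P (YE k r \<inter> ZE r) w)" using elim by simp
      also have "\<dots> = P (YE k q) w * (\<Sum>r<Q. P (ZE r) w)"
        unfolding sum_distrib_left using elim by (intro sum.cong) auto
      finally show ?case using elim by simp
    qed
  qed
  have PZq: "AE w in Mp. (\<Sum>k<K. P (XZ k) w) = prob (ZE q)"
  proof -
    have "(\<Union>k<K. XZ k) = ZE q" using obs_range by (auto simp: ZE_def XZ_def)
    moreover have "AE w in Mp. P (\<Union>k<K. XZ k) w = (\<Sum>k<K. P (XZ k) w)"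
      by (rule P_UN) (use XZ in \<open>auto simp: disjoint_family_on_def XZ_def\<close>)
    \<comment> \<open>Independence of \<open>U\<close> and \<open>Z\<close> makes this conditional
      probability constant; it is checked by integrating over preimages under \<open>U\<close>,
      which exhaust \<open>F\<close>.\<close>
    moreover have "AE w in Mp. P (ZE q) w = prob (ZE q)"
      unfolding P_def cprob_def
    proof (rule F.real_cond_exp_charact)
      fix A assume "A \<in> sets F"
      then obtain S where S: "S \<in> sets MU" and A: "A = U -` S \<inter> space Mp"
        using U unfolding F_def sigma_of_def
        by (subst (asm) sets_vimage_algebra2) (auto dest: measurable_space)
      have Aev: "A \<in> events" unfolding A by (rule measurable_sets[OF U S])
      have "indep_rv Mp MU U cnt Z" using I4 by (simp add: I4_def)
      from indep_rv_prob[OF this S, of "{q}"] have "prob (A \<inter> ZE q) = prob A * prob (ZE q)"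
        by (simp add: A ZE_def Int_def vimage_def conj_ac)
      moreover have "(\<integral>w\<in>A. indicator (ZE q) w \<partial>Mp) = prob (A \<inter> ZE q)"
        using Aev ZE by (simp add: set_lebesgue_integral_def flip: indicator_inter_arith)
      ultimately show "(\<integral>w\<in>A. indicator (ZE q) w \<partial>Mp) = (\<integral>w\<in>A. prob (ZE q) \<partial>Mp)"
        using Aev by (simp add: set_lebesgue_integral_def)
    qed (use ind_int[OF ZE] in auto)
    ultimately show ?thesis by auto
  qed
  have "prob (target V) * prob (ZE q) = (\<integral>w. P (target V) w * prob (ZE q) \<partial>Mp)"
    using P_int[OF target_event] by simp
  also have "\<dots> \<le> (\<integral>w. (\<Sum>k<K. P (YE k q \<inter> XZ k) w) \<partial>Mp)"
  proof (rule integral_mono_AE)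
    show "integrable Mp (\<lambda>w. P (target V) w * prob (ZE q))" using P_int[OF target_event] by simp
    show "integrable Mp (\<lambda>w. \<Sum>k<K. P (YE k q \<inter> XZ k) w)"
      using YE XZ q by (intro Bochner_Integration.integrable_sum P_int) auto
    \<comment> \<open>The same factor \<open>P (target V)\<close> bounds every \<open>k\<close>, so
      the sum over \<open>k\<close> collapses to the constant \<open>prob (ZE q)\<close>.\<close>
    have "AE w in Mp. \<forall>k\<in>{..<K}. P (target V) w * P (XZ k) w \<le> P (YE k q \<inter> XZ k) w"
    proof (rule AE_finite_allI)
      fix k assume "k \<in> {..<K}"
      then have "k < K" by simp
      show "AE w in Mp. P (target V) w * P (XZ k) w \<le> P (YE k q \<inter> XZ k) w"
        using target_le[OF \<open>k < K\<close>] P_nonneg[OF XZ[of k]] CI_XZ[OF \<open>k < K\<close>]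
        by eventually_elim (simp add: mult_right_mono)
    qed simp
    then show "AE w in Mp. P (target V) w * prob (ZE q) \<le> (\<Sum>k<K. P (YE k q \<inter> XZ k) w)"
      using PZq
    proof eventually_elim
      case (elim w)
      have "P (target V) w * prob (ZE q) = (\<Sum>k<K. P (target V) w * P (XZ k) w)"
        using elim by (simp flip: sum_distrib_left)
      also have "\<dots> \<le> (\<Sum>k<K. P (YE k q \<inter> XZ k) w)" using elim by (intro sum_mono) auto
      finally show ?case .
    qed
  qed
  also have "\<dots> = (\<Sum>k<K. prob (YE k q \<inter> XZ k))"
    using YE XZ q by (subst Bochner_Integration.integral_sum) (auto intro!: P_int sum.cong)
  also have "\<dots> = (\<Sum>k<K. prob {w \<in> space Mp. X w = k \<and> Y w \<in> V k \<and> Z w = q})"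
    using q by (simp add: prob_observed YE_def XZ_def)
  finally show ?thesis unfolding iv_ineq_def ZE_def .
qed

lemma IV_model_imp_iv_ineq:
  assumes "IV_model Mp K Q X Z Yp Xp U MU" "U \<in> measurable Mp MU" "q < Q"
    and "Xp q \<in> measurable Mp cnt" "\<And>w. w \<in> space Mp \<Longrightarrow> Xp q w < K"
  shows "iv_ineq V q"
  using assms(1) unfolding IV_model_def
proof (elim disjE conjE)
  assume "E1 Mp K Q Yp" "I1 Mp K Q Z Yp Xp"
  then show ?thesis using assms by (intro iv_ineq_of_I2 I2_of_I1 joint_prob_eq_of_E1)
next
  assume "E1 Mp K Q Yp" "I2 Mp K Q Z Yp"
  then show ?thesis using assms by (intro iv_ineq_of_I2 joint_prob_eq_of_E1)
next
  assume "E2 Mp K Q Yp" "I2 Mp K Q Z Yp"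
  then show ?thesis using assms by (intro iv_ineq_of_I2 joint_prob_eq_of_E2)
next
  assume "E1 Mp K Q Yp" "I3 Mp K Q Z Yp Xp" "consX Mp X Z Xp"
  then show ?thesis using assms by (intro iv_ineq_of_I3)
next
  assume "E3 Mp K Q Yp U MU" "I4 Mp K Q X Z Yp U MU"
  then show ?thesis using assms by (intro iv_ineq_of_I4)
qed

section \<open>The linear constraints at the true laws\<close>

lemma finite_tuples: "finite (tuples K M)"
  unfolding tuples_def by (intro finite_PiE) auto

text \<open>On \<open>tuples\<close>, \<open>P0\<close> is the mass function of the extensional
  random tuple of the \<open>Y(x_k)\<close>, so this is finite additivity.\<close>

lemma sum_P0:
  assumes "S \<subseteq> tuples K M"
  shows "(\<Sum>v\<in>S. P0 Mp K Z Yp v) = prob {w \<in> space Mp. (\<lambda>k\<in>{..<K}. Yp k (Z w) w) \<in> S}"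
proof -
  have eq: "{w \<in> space Mp. \<forall>k<K. Yp k (Z w) w = v k} = {w \<in> space Mp. (\<lambda>k\<in>{..<K}. Yp k (Z w) w) = v}"
    if "v \<in> tuples K M" for v
    using that by (auto simp: tuples_def PiE_iff extensional_def fun_eq_iff)
  have ev: "{w \<in> space Mp. \<forall>k<K. Yp k (Z w) w = v k} \<in> events" for v
    using target_event[of "\<lambda>k. {v k}"] by (simp only: target_def singleton_iff)
  have "(\<Sum>v\<in>S. P0 Mp K Z Yp v) = (\<Sum>v\<in>S. prob {w \<in> space Mp. (\<lambda>k\<in>{..<K}. Yp k (Z w) w) = v})"
    unfolding P0_def using eq assms by (intro sum.cong refl) auto
  also have "\<dots> = prob (\<Union>v\<in>S. {w \<in> space Mp. (\<lambda>k\<in>{..<K}. Yp k (Z w) w) = v})"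
  proof (rule finite_measure_finite_Union[symmetric])
    show "finite S" by (rule finite_subset[OF assms finite_tuples])
    show "(\<lambda>v. {w \<in> space Mp. (\<lambda>k\<in>{..<K}. Yp k (Z w) w) = v}) ` S \<subseteq> events"
    proof clarify
      fix v assume "v \<in> S"
      then show "{w \<in> space Mp. (\<lambda>k\<in>{..<K}. Yp k (Z w) w) = v} \<in> events"
        using ev[of v] eq[of v] assms by (metis (lifting) subsetD)
    qed
    show "disjoint_family_on (\<lambda>v. {w \<in> space Mp. (\<lambda>k\<in>{..<K}. Yp k (Z w) w) = v}) S"
      unfolding disjoint_family_on_def by blast
  qed
  also have "(\<Union>v\<in>S. {w \<in> space Mp. (\<lambda>k\<in>{..<K}. Yp k (Z w) w) = v})
      = {w \<in> space Mp. (\<lambda>k\<in>{..<K}. Yp k (Z w) w) \<in> S}" by auto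
  finally show ?thesis .
qed

lemma simplex_on_P0: "simplex_on (tuples K M) (P0 Mp K Z Yp)"
proof -
  have "{w \<in> space Mp. (\<lambda>k\<in>{..<K}. Yp k (Z w) w) \<in> tuples K M} = space Mp"
    using obs_range Yp_range by (auto simp: tuples_def)
  then show ?thesis
    using sum_P0[OF subset_refl] by (simp add: simplex_on_def prob_space) (simp add: P0_def)
qed

lemma H'_P0:
  assumes "V \<in> PiE {..<K} (\<lambda>_. Pow {..<M})"
  shows "(\<Sum>v\<in>tuples K M. H'_entry K V v * P0 Mp K Z Yp v) = prob (target V)"
proof -
  have sub: "PiE {..<K} V \<subseteq> tuples K M"
    unfolding tuples_def using assms by (intro PiE_mono) auto
  have "(\<Sum>v\<in>tuples K M. H'_entry K V v * P0 Mp K Z Yp v) = (\<Sum>v\<in>PiE {..<K} V. P0 Mp K Z Yp v)"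
    using sub finite_tuples by (intro sum.mono_neutral_cong_right) (auto simp: H'_entry_def)
  also have "\<dots> = prob (target V)"
    unfolding sum_P0[OF sub] by (intro arg_cong[where f = prob]) (auto simp: target_def)
  finally show ?thesis .
qed

lemma cond_XY_sum:
  assumes "finite S"
  shows "(\<Sum>m\<in>S. cond_XY Mp X Y Z q (k, m))
       = prob {w \<in> space Mp. X w = k \<and> Y w \<in> S \<and> Z w = q} / prob {w \<in> space Mp. Z w = q}"
proof -
  have ev: "{w \<in> space Mp. X w = k \<and> Y w = m \<and> Z w = q} \<in> events" for m
    using cnt_event[OF Y_meas, of "{m}"] by (intro sets.sets_Collect_conj X_event Z_event) simp
  have "(\<Sum>m\<in>S. prob {w \<in> space Mp. X w = k \<and> Y w = m \<and> Z w = q})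
      = prob (\<Union>m\<in>S. {w \<in> space Mp. X w = k \<and> Y w = m \<and> Z w = q})"
    using ev assms by (intro finite_measure_finite_Union[symmetric]) (auto simp: disjoint_family_on_def)
  also have "(\<Union>m\<in>S. {w \<in> space Mp. X w = k \<and> Y w = m \<and> Z w = q})
      = {w \<in> space Mp. X w = k \<and> Y w \<in> S \<and> Z w = q}" by auto
  finally show ?thesis by (simp add: cond_XY_def flip: sum_divide_distrib)
qed

lemma H_cond_XY:
  assumes "V \<in> PiE {..<K} (\<lambda>_. Pow {..<M})"
  shows "(\<Sum>a\<in>cells K M. H_entry K V a * cond_XY Mp X Y Z q a)
       = (\<Sum>k<K. prob {w \<in> space Mp. X w = k \<and> Y w \<in> V k \<and> Z w = q}) / prob {w \<in> space Mp. Z w = q}"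
proof -
  have VM: "V k \<subseteq> {..<M}" if "k < K" for k using assms that by auto
  have "(\<Sum>a\<in>cells K M. H_entry K V a * cond_XY Mp X Y Z q a)
      = (\<Sum>a\<in>(SIGMA k:{..<K}. V k). cond_XY Mp X Y Z q a)"
    using VM by (intro sum.mono_neutral_cong_right) (auto simp: H_entry_def cells_def)
  also have "\<dots> = (\<Sum>k<K. \<Sum>m\<in>V k. cond_XY Mp X Y Z q (k, m))"
    using VM by (subst sum.Sigma) (auto intro: finite_subset)
  also have "\<dots> = (\<Sum>k<K. prob {w \<in> space Mp. X w = k \<and> Y w \<in> V k \<and> Z w = q} / prob {w \<in> space Mp. Z w = q})"
    using VM by (intro sum.cong refl cond_XY_sum) (auto intro: finite_subset)
  finally show ?thesis by (simp add: sum_divide_distrib)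
qed

text \<open>Confines the support of the sampling law \<open>D q\<close> to \<open>cells\<close>, so
  that its mass function is a point of the simplex.\<close>

lemma cond_XY_outside:
  assumes "a \<notin> cells K M" shows "cond_XY Mp X Y Z q a = 0"
proof -
  have "{w \<in> space Mp. X w = fst a \<and> Y w = snd a \<and> Z w = q} = {}"
    using assms obs_range by (cases a) (auto simp: cells_def)
  then show ?thesis unfolding cond_XY_def by (simp only: measure_empty div_0)
qed

end

section \<open>Coverage of the confidence intervals\<close>

theorem theorem4:
  fixes Mp :: "'w measure" and MU :: "'u measure" and U :: "'w \<Rightarrow> 'u"
    and K M Q J :: nat and n :: "nat \<Rightarrow> nat"
    and X Y Z :: "'w \<Rightarrow> nat" and Yp :: "nat \<Rightarrow> nat \<Rightarrow> 'w \<Rightarrow> nat" and Xp :: "nat \<Rightarrow> 'w \<Rightarrow> nat"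
    and D :: "nat \<Rightarrow> (nat \<times> nat) pmf"
    and c :: "nat \<Rightarrow> (nat \<Rightarrow> nat) \<Rightarrow> real"
    and \<alpha> t :: real
  assumes "prob_space Mp"
    and "K \<ge> 1" "M \<ge> 1" "Q \<ge> 1"
    and "Z \<in> measurable Mp cnt" "X \<in> measurable Mp cnt" "Y \<in> measurable Mp cnt"
    and "\<And>k q. k < K \<Longrightarrow> q < Q \<Longrightarrow> Yp k q \<in> measurable Mp cnt"
    and "\<And>q. q < Q \<Longrightarrow> Xp q \<in> measurable Mp cnt"
    and "U \<in> measurable Mp MU"
    and "\<And>w. w \<in> space Mp \<Longrightarrow> Z w < Q \<and> X w < K \<and> Y w < M"
    and "\<And>w k q. w \<in> space Mp \<Longrightarrow> k < K \<Longrightarrow> q < Q \<Longrightarrow> Yp k q w < M"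
    and "\<And>w q. w \<in> space Mp \<Longrightarrow> q < Q \<Longrightarrow> Xp q w < K"
    and "AE w in Mp. Y w = Yp (X w) (Z w) w"
    and "\<And>q. q < Q \<Longrightarrow> measure Mp {w\<in>space Mp. Z w = q} > 0"
    and "IV_model Mp K Q X Z Yp Xp U MU"
    and "\<And>q a. q < Q \<Longrightarrow> pmf (D q) a = cond_XY Mp X Y Z q a"
    and "\<And>q. q < Q \<Longrightarrow> n q \<ge> 1"
    and "(INF l\<in>{0..1}. exp (- l * t) * (\<Prod>q<Q. G_poly (K * M) (n q) l)) \<le> \<alpha>"
  shows "measure_pmf.prob (Pi_pmf (sample_index Q n) (0, 0) (\<lambda>(q, i). D q))
           {s. \<forall>j<J.
               lower_bd K M Q n t (emp_dist n s) (c j) \<le> upper_bd K M Q n t (emp_dist n s) (c j)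
             \<and> lower_bd K M Q n t (emp_dist n s) (c j) \<le> ereal (lin_fun K M (c j) (P0 Mp K Z Yp))
             \<and> ereal (lin_fun K M (c j) (P0 Mp K Z Yp)) \<le> upper_bd K M Q n t (emp_dist n s) (c j)}
         \<ge> 1 - \<alpha>"
proof -
  interpret iv_data Mp K M Q X Y Z Yp
    by (intro iv_data.intro iv_data_axioms.intro assms; assumption)
  define A where "A = cells K M"
  define P where "P = Pi_pmf (sample_index Q n) (0, 0) (\<lambda>(q, i). D q)"
  define KLsum where "KLsum s = (\<Sum>q<Q. ereal (real (n q)) * KL_div A (emp_dist n s q) (pmf (D q)))" for s
  define covers where "covers s \<longleftrightarrow> (\<forall>j<J.
        lower_bd K M Q n t (emp_dist n s) (c j) \<le> upper_bd K M Q n t (emp_dist n s) (c j)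
      \<and> lower_bd K M Q n t (emp_dist n s) (c j) \<le> ereal (lin_fun K M (c j) (P0 Mp K Z Yp))
      \<and> ereal (lin_fun K M (c j) (P0 Mp K Z Yp)) \<le> upper_bd K M Q n t (emp_dist n s) (c j))" for s
  have D: "pmf (D q) a = cond_XY Mp X Y Z q a" if "q < Q" for q a
    using that by fact
  have n: "n q \<ge> 1" if "q < Q" for q
    using that by fact
  have A: "finite A" "A \<noteq> {}" "card A = K * M"
    using \<open>K \<ge> 1\<close> \<open>M \<ge> 1\<close> by (auto simp: A_def cells_def lessThan_empty_iff)
  have supp: "set_pmf (D q) \<subseteq> A" if "q < Q" for q
    using cond_XY_outside D[OF that] by (auto simp: A_def set_pmf_eq)
  have row: "(\<Sum>v\<in>tuples K M. H'_entry K V v * P0 Mp K Z Yp v) \<le> (\<Sum>a\<in>cells K M. H_entry K V a * pmf (D q) a)"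
    if q: "q < Q" and V: "V \<in> IV_rows K M" for q V
  proof -
    have V': "V \<in> PiE {..<K} (\<lambda>_. Pow {..<M})"
      using V by (auto simp: IV_rows_def PiE_iff)
    \<comment> \<open>The product form becomes the row constraint on dividing by
      \<open>P(Z = q) > 0\<close>.\<close>
    have "iv_ineq V q"
      using IV_model_imp_iv_ineq[of Xp U MU q V] assms q by blast
    then show ?thesis
      unfolding H'_P0[OF V'] D[OF q] H_cond_XY[OF V'] iv_ineq_def
      using Z_pos[OF q] by (simp add: pos_le_divide_eq)
  qed
  \<comment> \<open>One feasible point, the true pair, witnesses all \<open>J\<close> intervals at
    once, so simultaneity costs no correction.\<close>
  have "covers s" if "KLsum s \<le> ereal t" for s
  proof -
    have "simplex_on (cells K M) (pmf (D q))" if "q < Q" for q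
      using supp[OF that] A by (simp add: simplex_on_def sum_pmf_eq_1 A_def)
    then have "feasible K M Q n t (emp_dist n s) (P0 Mp K Z Yp) (\<lambda>q. pmf (D q))"
      using that row simplex_on_P0 unfolding feasible_def KLsum_def A_def by blast
    then have mem: "ereal (lin_fun K M (c j) (P0 Mp K Z Yp))
        \<in> {ereal (lin_fun K M (c j) p') | p' p. feasible K M Q n t (emp_dist n s) p' p}" for j
      by blast
    have "lower_bd K M Q n t (emp_dist n s) (c j) \<le> ereal (lin_fun K M (c j) (P0 Mp K Z Yp))"
      and "ereal (lin_fun K M (c j) (P0 Mp K Z Yp)) \<le> upper_bd K M Q n t (emp_dist n s) (c j)" for j
      unfolding lower_bd_def upper_bd_def by (rule Inf_lower[OF mem] Sup_upper[OF mem])+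
    then show ?thesis unfolding covers_def by (blast intro: order_trans)
  qed
  then have "- {s. covers s} \<subseteq> {s. \<not> KLsum s \<le> ereal t}" by blast
  then have "measure_pmf.prob P (- {s. covers s}) \<le> measure_pmf.prob P {s. \<not> KLsum s \<le> ereal t}"
    by (intro measure_pmf.finite_measure_mono) auto
  \<comment> \<open>The event on the left does not depend on \<open>l\<close>, so the tail bounds
    for all \<open>l\<close> pass to the infimum.\<close>
  also have "\<dots> \<le> (INF l\<in>{0..1}. exp (- l * t) * (\<Prod>q<Q. G_poly (K * M) (n q) l))"
  proof (rule cINF_greatest)
    fix l :: real assume "l \<in> {0..1}"
    then show "measure_pmf.prob P {s. \<not> KLsum s \<le> ereal t} \<le> exp (- l * t) * (\<Prod>q<Q. G_poly (K * M) (n q) l)"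
      unfolding P_def KLsum_def A(3)[symmetric] using A n supp by (intro empirical_KL_tail) auto
  qed simp
  also have "\<dots> \<le> \<alpha>" by fact
  finally have "1 - \<alpha> \<le> measure_pmf.prob P {s. covers s}"
    using measure_pmf.prob_compl[of "{s. covers s}" P] by (simp add: Compl_eq_Diff_UNIV)
  then show ?thesis unfolding P_def covers_def .
qed

end
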